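(* Let $(J,\circ)$ be a $3$-dimensional Jordan algebra over $\mathbb{C}$, let $R:J\to J$ be a Rota-Baxter operator (of weight $0$) on $(J,\circ)$, and let $(J,\cdot)$ be the induced pre-Jordan algebra, $x\cdot y:=R(x)\circ y$. Then $(J,\cdot)$ is isomorphic to one of the following pre-Jordan algebras, given by their formal characteristic matrices with respect to a basis $\{e_1,e_2,e_3\}$: $$\mathcal{J}_{4,8}:\begin{pmatrix} e_1&e_2&2e_3\\0&0&0\\0&0&0\end{pmatrix},\quad A_{{\bf 1}_3,2}:\begin{pmatrix} e_1&2e_2&2e_3\\0&e_3&0\\0&0&0\end{pmatrix},\quad A_{{\bf 1}_4,3}:\begin{pmatrix} e_1&2e_2&2e_3\\0&0&0\\0&0&0\end{pmatrix},\quad A_{2,2}:\begin{pmatrix} 0&0&0\\0&e_2&2e_3\\0&0&0\end{pmatrix},$$ $$A_{4,1}(\alpha):\begin{pmatrix} e_2&(1+\alpha)e_3&0\\(1-\alpha)e_3&0&0\\0&0&0\end{pmatrix}\ \text{with }\alpha\in\{0,\tfrac13,1\},\quad A_{6,1}(\alpha):\begin{pmatrix} 0&(1+\sqrt{\alpha})e_3&0\\(1-\sqrt{\alpha})e_3&0&0\\0&0&0\end{pmatrix}\ \text{with }\alpha\in\mathbb{C},$$ $$A_{7,2}:\begin{pmatrix} 0&0&0\\0&e_3&0\\0&0&0\end{pmatrix},\quad A_{8,1}:\begin{pmatrix} 0&0&0\\0&0&0\\0&0&0\end{pmatrix}.$$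
   Context: All vector spaces and algebras are over $\mathbb{C}$. A Jordan algebra is a vector space $J$ with a commutative bilinear multiplication $\circ$ satisfying $((x\circ x)\circ y)\circ x=(x\circ x)\circ(y\circ x)$ for all $x,y$. A Rota-Baxter operator (of weight $0$) on $(J,\circ)$ is a linear map $R:J\to J$ with $R(x)\circ R(y)=R(R(x)\circ y+x\circ R(y))$ for all $x,y\in J$. A pre-Jordan algebra is a vector space $A$ with a bilinear multiplication $\cdot$ such that, writing $x\circ y:=x\cdot y+y\cdot x$, for all $x,y,z,u$: $$(x\circ y)\cdot(z\cdot u)+(y\circ z)\cdot(x\cdot u)+(z\circ x)\cdot(y\cdot u)= x\cdot(y\cdot(z\cdot u))+z\cdot(y\cdot(x\cdot u))+((x\circ z)\circ y)\cdot u= z\cdot((x\circ y)\cdot u)+x\cdot((y\circ z)\cdot u)+y\cdot((z\circ x)\cdot u).$$ If $R$ is a Rota-Baxter operator on $(J,\circ)$, then $x\cdot y:=R(x)\circ y$ is known to define a pre-Jordan algebra on $J$ (whose anticommutator need not be the original $\circ$), called the induced pre-Jordan algebra. Isomorphisms are bijective linear maps preserving multiplication. The formal characteristic matrix of an algebra with basis $\{e_i\}$ has $(i,j)$ entry $e_i\cdot e_j$. In $A_{6,1}(\alpha)$, $\sqrt{\alpha}$ denotes a complex square root of $\alpha$. *)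

theory Defs
  imports "HOL-Analysis.Analysis"
begin

locale complex_algebra = vector_space smul
  for smul :: "complex \<Rightarrow> 'a::ab_group_add \<Rightarrow> 'a" +
  fixes mul :: "'a \<Rightarrow> 'a \<Rightarrow> 'a"
  assumes linear_left: "Vector_Spaces.linear smul smul (\<lambda>x. mul x y)"
    and linear_right: "Vector_Spaces.linear smul smul (\<lambda>y. mul x y)"
begin

lemma mult_add_left: "mul (x + y) z = mul x z + mul y z"
  using linear_left[of z] by (simp add: Vector_Spaces.linear_iff)

lemma mult_add_right: "mul x (y + z) = mul x y + mul x z"
  using linear_right[of x] by (simp add: Vector_Spaces.linear_iff)

lemma mult_scale_left: "mul (smul c x) y = smul c (mul x y)"
  using linear_left[of y] by (simp add: Vector_Spaces.linear_iff)

lemma mult_scale_right: "mul x (smul c y) = smul c (mul x y)"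
  using linear_right[of x] by (simp add: Vector_Spaces.linear_iff)

end

locale jordan_algebra = complex_algebra +
  assumes commute: "mul x y = mul y x"
    and jordan_identity: "mul (mul (mul x x) y) x = mul (mul x x) (mul y x)"

text \<open>Rota-Baxter operators are those of weight 0.\<close>

definition rota_baxter_operator ::
  "(complex \<Rightarrow> 'a::ab_group_add \<Rightarrow> 'a) \<Rightarrow> ('a \<Rightarrow> 'a \<Rightarrow> 'a) \<Rightarrow> ('a \<Rightarrow> 'a) \<Rightarrow> bool" where
  "rota_baxter_operator smul mul R \<longleftrightarrow>
     Vector_Spaces.linear smul smul R \<and>
     (\<forall>x y. mul (R x) (R y) = R (mul (R x) y + mul x (R y)))"

definition induced_mult :: "('a \<Rightarrow> 'a \<Rightarrow> 'a) \<Rightarrow> ('a \<Rightarrow> 'a) \<Rightarrow> 'a \<Rightarrow> 'a \<Rightarrow> 'a" where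
  "induced_mult mul R x y = mul (R x) y"

definition anticommutator :: "('a \<Rightarrow> 'a \<Rightarrow> 'a::ab_group_add) \<Rightarrow> 'a \<Rightarrow> 'a \<Rightarrow> 'a" where
  "anticommutator mul x y = mul x y + mul y x"

locale pre_jordan_algebra = complex_algebra +
  assumes pre_jordan_1:
    "mul (anticommutator mul x y) (mul z u) + mul (anticommutator mul y z) (mul x u)
       + mul (anticommutator mul z x) (mul y u)
     = mul x (mul y (mul z u)) + mul z (mul y (mul x u))
       + mul (anticommutator mul (anticommutator mul x z) y) u"
    and pre_jordan_2:
    "mul x (mul y (mul z u)) + mul z (mul y (mul x u))
       + mul (anticommutator mul (anticommutator mul x z) y) u
     = mul z (mul (anticommutator mul x y) u) + mul x (mul (anticommutator mul y z) u)
       + mul y (mul (anticommutator mul z x) u)"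

definition algebra_isomorphism ::
  "(complex \<Rightarrow> 'a::ab_group_add \<Rightarrow> 'a) \<Rightarrow> ('a \<Rightarrow> 'a \<Rightarrow> 'a) \<Rightarrow>
   (complex \<Rightarrow> 'b::ab_group_add \<Rightarrow> 'b) \<Rightarrow> ('b \<Rightarrow> 'b \<Rightarrow> 'b) \<Rightarrow> ('a \<Rightarrow> 'b) \<Rightarrow> bool" where
  "algebra_isomorphism smul1 mul1 smul2 mul2 f \<longleftrightarrow>
     Vector_Spaces.linear smul1 smul2 f \<and> bij f \<and>
     (\<forall>x y. f (mul1 x y) = mul2 (f x) (f y))"

definition isomorphic_algebras ::
  "(complex \<Rightarrow> 'a::ab_group_add \<Rightarrow> 'a) \<Rightarrow> ('a \<Rightarrow> 'a \<Rightarrow> 'a) \<Rightarrow>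
   (complex \<Rightarrow> 'b::ab_group_add \<Rightarrow> 'b) \<Rightarrow> ('b \<Rightarrow> 'b \<Rightarrow> 'b) \<Rightarrow> bool" where
  "isomorphic_algebras smul1 mul1 smul2 mul2 \<longleftrightarrow>
     (\<exists>f. algebra_isomorphism smul1 mul1 smul2 mul2 f)"

text \<open>The product on $\mathbb{C}^3$ determined by a formal characteristic matrix: the entry
  \<open>M $ i $ j\<close> is the product of the \<open>i\<close>-th and the \<open>j\<close>-th standard basis vector.\<close>

definition table_mult :: "complex^3^3^3 \<Rightarrow> complex^3 \<Rightarrow> complex^3 \<Rightarrow> complex^3" where
  "table_mult M x y = (\<Sum>i\<in>UNIV. \<Sum>j\<in>UNIV. (x $ i * y $ j) *s (M $ i $ j))"

abbreviation e1 :: "complex^3" where "e1 \<equiv> axis 1 1"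
abbreviation e2 :: "complex^3" where "e2 \<equiv> axis 2 1"
abbreviation e3 :: "complex^3" where "e3 \<equiv> axis 3 1"

lemma table_mult_basis: "table_mult M (axis i 1) (axis j 1) = M $ i $ j"
proof -
  have "(\<Sum>j'\<in>UNIV. (axis i 1 $ i' * axis j 1 $ j') *s (M $ i' $ j')) = (if i' = i then M $ i $ j else 0)"
    for i'
    by (simp add: axis_def if_distrib[of "\<lambda>c. c *s _"] cong: if_cong)
  thus ?thesis by (simp add: table_mult_def)
qed

definition J_4_8 :: "complex^3^3^3" where
  "J_4_8 = vector [vector [e1, e2, 2 *s e3],
                   vector [0, 0, 0],
                   vector [0, 0, 0]]"

definition A_1_3_2 :: "complex^3^3^3" where
  "A_1_3_2 = vector [vector [e1, 2 *s e2, 2 *s e3],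
                     vector [0, e3, 0],
                     vector [0, 0, 0]]"

definition A_1_4_3 :: "complex^3^3^3" where
  "A_1_4_3 = vector [vector [e1, 2 *s e2, 2 *s e3],
                     vector [0, 0, 0],
                     vector [0, 0, 0]]"

definition A_2_2 :: "complex^3^3^3" where
  "A_2_2 = vector [vector [0, 0, 0],
                   vector [0, e2, 2 *s e3],
                   vector [0, 0, 0]]"

definition A_4_1 :: "complex \<Rightarrow> complex^3^3^3" where
  "A_4_1 \<alpha> = vector [vector [e2, (1 + \<alpha>) *s e3, 0],
                     vector [(1 - \<alpha>) *s e3, 0, 0],
                     vector [0, 0, 0]]"

text \<open>The principal square root is used; the other choice gives an isomorphic algebra, the
  isomorphism exchanging the first two basis vectors.\<close>

definition A_6_1 :: "complex \<Rightarrow> complex^3^3^3" where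
  "A_6_1 \<alpha> = vector [vector [0, (1 + csqrt \<alpha>) *s e3, 0],
                     vector [(1 - csqrt \<alpha>) *s e3, 0, 0],
                     vector [0, 0, 0]]"

definition A_7_2 :: "complex^3^3^3" where
  "A_7_2 = vector [vector [0, 0, 0],
                   vector [0, e3, 0],
                   vector [0, 0, 0]]"

definition A_8_1 :: "complex^3^3^3" where
  "A_8_1 = vector [vector [0, 0, 0],
                   vector [0, 0, 0],
                   vector [0, 0, 0]]"

context jordan_algebra
begin

lemma jordan_linearized:
  "mul (mul a b) (mul c u) + mul (mul b c) (mul a u) + mul (mul c a) (mul b u)
   = mul c (mul (mul a b) u) + mul a (mul (mul b c) u) + mul b (mul (mul c a) u)"
proof -
  define f where "f x = mul x (mul (mul x x) u) - mul (mul x x) (mul x u)" for x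
  have f0: "f x = 0" for x
    unfolding f_def by (metis commute jordan_identity diff_self)
  define d where "d = (mul c (mul (mul a b) u) + mul a (mul (mul b c) u)
      + mul b (mul (mul c a) u)) - (mul (mul a b) (mul c u)
      + mul (mul b c) (mul a u) + mul (mul c a) (mul b u))"
  have "f (a + b + c) - f (a + b) - f (b + c) - f (c + a) + f a + f b + f c = d + d"
    by (simp add: f_def d_def mult_add_left mult_add_right commute[of b a] commute[of c a]
        commute[of c b] algebra_simps)
  hence "d + d = 0" by (simp add: f0)
  hence "smul (1 + 1) d = 0" by (simp only: scale_left_distrib scale_one)
  hence "d = 0" by simp
  thus ?thesis by (simp add: d_def)
qed

theorem induced_pre_jordan:
  assumes "rota_baxter_operator smul mul R"
  shows "pre_jordan_algebra smul (induced_mult mul R)"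
proof -
  have R: "Vector_Spaces.linear smul smul R"
    and rb: "\<And>x y. mul (R x) (R y) = R (mul (R x) y + mul x (R y))"
    using assms by (auto simp: rota_baxter_operator_def)
  have Ranti: "R (anticommutator (induced_mult mul R) x y) = mul (R x) (R y)" for x y
    by (simp add: anticommutator_def induced_mult_def rb commute[of x "R y"])
  show ?thesis
  proof (intro pre_jordan_algebra.intro complex_algebra.intro complex_algebra_axioms.intro
      pre_jordan_algebra_axioms.intro)
    show "vector_space smul" by (rule vector_space_axioms)
    show "Vector_Spaces.linear smul smul (\<lambda>x. induced_mult mul R x y)" for y
      using R by (simp add: induced_mult_def Vector_Spaces.linear_iff mult_add_left mult_scale_left)
    show "Vector_Spaces.linear smul smul (\<lambda>y. induced_mult mul R x y)" for x
      using linear_right[of "R x"] by (simp add: induced_mult_def)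
  next
    fix x y z u
    let ?m = "induced_mult mul R" and ?a = "anticommutator (induced_mult mul R)"
    have m: "?m v w = mul (R v) w" for v w by (simp add: induced_mult_def)
    let ?a1 = "R x" and ?b = "R y" and ?c = "R z"
    note L1 = jordan_linearized[of ?a1 ?b ?c u]
    note L2 = jordan_linearized[of ?a1 ?c u ?b]
    have e12: "mul (mul ?a1 ?b) (mul ?c u) + mul (mul ?b ?c) (mul ?a1 u)
        + mul (mul ?c ?a1) (mul ?b u)
      = mul ?a1 (mul ?b (mul ?c u)) + mul ?c (mul ?b (mul ?a1 u))
        + mul (mul (mul ?a1 ?c) ?b) u"
      using L2 unfolding commute[of u ?b] commute[of u ?a1] commute[of ?c ?a1] commute[of ?c ?b]
        commute[of "mul ?c u" "mul ?a1 ?b"] commute[of "mul ?a1 u" "mul ?b ?c"]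
        commute[of u "mul (mul ?a1 ?c) ?b"] commute[of "mul ?c u" ?b] commute[of "mul ?a1 u" ?b]
      by (simp add: add_ac)
    show "?m (?a x y) (?m z u) + ?m (?a y z) (?m x u) + ?m (?a z x) (?m y u)
      = ?m x (?m y (?m z u)) + ?m z (?m y (?m x u)) + ?m (?a (?a x z) y) u"
      using e12 by (simp only: m Ranti)
    show "?m x (?m y (?m z u)) + ?m z (?m y (?m x u)) + ?m (?a (?a x z) y) u
      = ?m z (?m (?a x y) u) + ?m x (?m (?a y z) u) + ?m y (?m (?a z x) u)"
      using e12 L1 by (simp only: m Ranti)
  qed
qed

end

lemmas table_defs = J_4_8_def A_1_3_2_def A_1_4_3_def A_2_2_def A_4_1_def A_6_1_def A_7_2_def
  A_8_1_def

lemma complex_algebra_table_mult: "complex_algebra (*s) (table_mult M)"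
proof (intro complex_algebra.intro complex_algebra_axioms.intro)
  show "vector_space ((*s) :: complex \<Rightarrow> complex^3 \<Rightarrow> complex^3)"
    by (rule vec.vector_space_axioms)
  show "Vector_Spaces.linear (*s) (*s) (\<lambda>x. table_mult M x y)" for y
    by (simp add: Vector_Spaces.linear_iff vec.vector_space_axioms table_mult_def sum_3 vec_eq_iff
        algebra_simps)
  show "Vector_Spaces.linear (*s) (*s) (\<lambda>y. table_mult M x y)" for x
    by (simp add: Vector_Spaces.linear_iff vec.vector_space_axioms table_mult_def sum_3 vec_eq_iff
        algebra_simps)
qed

lemma table_mult_simps:
  "table_mult J_4_8 x y = vector [x$1 * y$1, x$1 * y$2, 2 * x$1 * y$3]"
  "table_mult A_1_3_2 x y = vector [x$1 * y$1, 2 * x$1 * y$2, 2 * x$1 * y$3 + x$2 * y$2]"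
  "table_mult A_1_4_3 x y = vector [x$1 * y$1, 2 * x$1 * y$2, 2 * x$1 * y$3]"
  "table_mult A_2_2 x y = vector [0, x$2 * y$2, 2 * x$2 * y$3]"
  "table_mult (A_4_1 \<alpha>) x y =
     vector [0, x$1 * y$1, (1 + \<alpha>) * x$1 * y$2 + (1 - \<alpha>) * x$2 * y$1]"
  "table_mult (A_6_1 \<alpha>) x y =
     vector [0, 0, (1 + csqrt \<alpha>) * x$1 * y$2 + (1 - csqrt \<alpha>) * x$2 * y$1]"
  "table_mult A_7_2 x y = vector [0, 0, x$2 * y$2]"
  "table_mult A_8_1 x y = 0"
  by (simp_all add: table_mult_def sum_3 vec_eq_iff forall_3 table_defs axis_def algebra_simps)

lemma pre_jordan_tables:
  assumes "M \<in> {J_4_8, A_1_3_2, A_1_4_3, A_2_2, A_7_2, A_8_1} \<union> range A_4_1 \<union> range A_6_1"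
  shows "pre_jordan_algebra (*s) (table_mult M)"
proof -
  have "pre_jordan_algebra_axioms (table_mult J_4_8)"
    "pre_jordan_algebra_axioms (table_mult A_1_3_2)"
    "pre_jordan_algebra_axioms (table_mult A_1_4_3)"
    "pre_jordan_algebra_axioms (table_mult A_2_2)"
    "pre_jordan_algebra_axioms (table_mult A_7_2)"
    "pre_jordan_algebra_axioms (table_mult A_8_1)"
    "pre_jordan_algebra_axioms (table_mult (A_4_1 \<alpha>))"
    "pre_jordan_algebra_axioms (table_mult (A_6_1 \<alpha>))" for \<alpha>
    unfolding pre_jordan_algebra_axioms_def anticommutator_def table_mult_simps
    by (simp_all add: vec_eq_iff forall_3 algebra_simps)
  with assms have "pre_jordan_algebra_axioms (table_mult M)" by blast
  thus ?thesis
    by (rule pre_jordan_algebra.intro[OF complex_algebra_table_mult])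
qed

end

theory Submission
  imports Defs
begin

text \<open>
  Write \<open>\<circ>\<close> for the Jordan product. Left multiplication by \<open>x\<close> in the induced algebra is
  Jordan multiplication by \<open>R x\<close>, so everything depends on the range of \<open>R\<close>, which the
  Rota-Baxter identity makes a subalgebra. The proof asks whether this subalgebra contains a nonzero
  idempotent.

  Suppose \<open>e = R y\<close> is a nonzero idempotent. The Rota-Baxter identity shows that the
  component of \<open>y\<close> in the Peirce space \<open>J\<^sub>1\<^sub>/\<^sub>2(e)\<close> already maps to \<open>e\<close>. Hence \<open>e\<close>, that
  component \<open>x\<close> and one more eigenvector \<open>z\<close> of multiplication by \<open>e\<close> form a basis. For each of
  the eigenvalues 1/2, 0 and 1 of \<open>z\<close>, the Peirce rules leave few structure constants, and
  comparing coordinates in the Rota-Baxter identity determines \<open>R\<close>: the results are \<open>J_4_8\<close>,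
  \<open>A_2_2\<close>, and \<open>A_1_3_2\<close> or \<open>A_1_4_3\<close> respectively (\<open>classified_if_idempotent_in_range\<close>).

  Otherwise every \<open>b\<close> in the range satisfies \<open>b\<^sup>4 = 0\<close>: Jordan algebras are power associative, and
  a linear relation between the first four powers of an element that is not nilpotent produces an
  idempotent (\<open>nilpotent_if_no_idempotent\<close>). Three cases remain.
  \<^item> Some \<open>b\<close> in the range has \<open>b\<^sup>3 \<noteq> 0\<close>. Then \<open>b, b\<^sup>2, b\<^sup>3\<close> is a basis and \<open>R\<close> can be computed;
    \<open>A_4_1 (1/3)\<close> appears here (\<open>classified_power_basis\<close>).
  \<^item> All cubes of elements of the range vanish, but some square does not. If \<open>R\<close> is surjective,
    \<open>J \<circ> J\<close> is a line annihilated by \<open>J\<close>. If not, the range is spanned by \<open>b\<close> and \<open>b\<^sup>2\<close> and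
    annihilates the kernel of \<open>R\<close>; the Jordan identities restrict one remaining eigenvalue to three
    values, which give the three algebras \<open>A_4_1\<close> (\<open>classified_if_range_cubes_vanish\<close>).
  \<^item> The product vanishes on the range. Rank one gives powers of a single nilpotent operator,
    whence \<open>A_4_1 1\<close> or a product with values in a line; in rank two the product has values in the
    kernel of \<open>R\<close> (\<open>classified_if_range_null\<close>).

  A product with values in an annihilating line is a bilinear form on a plane. Over the complex
  numbers it is \<open>A_6_1\<close>, \<open>A_7_2\<close> or \<open>A_8_1\<close>, unless its symmetric part is degenerate while the
  form is not symmetric (\<open>classified_bilinear_form\<close>). The excluded forms do not arise from
  Rota-Baxter operators, because the Gram matrix \<open>Q\<close> of \<open>\<circ>\<close> and the matrix \<open>A\<close> of \<open>R\<close> on the plane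
  satisfy \<open>A Q A\<^sup>T = c (A Q + Q A\<^sup>T)\<close>.
\<close>


section \<open>Coordinates in dimension three\<close>

locale complex_space = vector_space smul
  for smul :: "complex \<Rightarrow> 'b::ab_group_add \<Rightarrow> 'b"
begin

definition comb :: "'b \<Rightarrow> 'b \<Rightarrow> 'b \<Rightarrow> complex \<Rightarrow> complex \<Rightarrow> complex \<Rightarrow> 'b" where
  "comb u v w a b c = smul a u + smul b v + smul c w"

definition basis3 :: "'b \<Rightarrow> 'b \<Rightarrow> 'b \<Rightarrow> bool" where
  "basis3 u v w \<longleftrightarrow> (\<forall>a b c. comb u v w a b c = 0 \<longrightarrow> a = 0 \<and> b = 0 \<and> c = 0)
     \<and> (\<forall>z. \<exists>a b c. z = comb u v w a b c)"

text \<open>In a fixed basis, the rules below turn every vector equation into three scalar equations: all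
  calculations in later sections rewrite vectors to this form and compare coefficients.\<close>

lemma comb_add: "comb u v w a b c + comb u v w a' b' c' = comb u v w (a + a') (b + b') (c + c')"
  by (simp add: comb_def scale_left_distrib algebra_simps)

lemma comb_diff: "comb u v w a b c - comb u v w a' b' c' = comb u v w (a - a') (b - b') (c - c')"
  by (simp add: comb_def scale_left_diff_distrib algebra_simps)

lemma comb_scale: "smul k (comb u v w a b c) = comb u v w (k * a) (k * b) (k * c)"
  by (simp add: comb_def scale_right_distrib)

lemma comb_zero: "comb u v w 0 0 0 = 0"
  by (simp add: comb_def)

lemma comb_unit: "comb u v w 1 0 0 = u" "comb u v w 0 1 0 = v" "comb u v w 0 0 1 = w"
  by (simp_all add: comb_def)

lemmas comb_simps = comb_add comb_diff comb_scale

lemma comb_eq_iff: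
  assumes "basis3 u v w"
  shows "comb u v w a b c = comb u v w a' b' c' \<longleftrightarrow> a = a' \<and> b = b' \<and> c = c'"
proof
  assume "comb u v w a b c = comb u v w a' b' c'"
  hence "comb u v w (a - a') (b - b') (c - c') = 0"
    by (metis comb_diff right_minus_eq)
  thus "a = a' \<and> b = b' \<and> c = c'"
    using assms unfolding basis3_def by (metis right_minus_eq)
qed simp

lemma comb_eq_0_iff:
  "basis3 u v w \<Longrightarrow> comb u v w a b c = 0 \<longleftrightarrow> a = 0 \<and> b = 0 \<and> c = 0"
  using comb_eq_iff[of u v w a b c 0 0 0] by (simp add: comb_zero)

lemma basis3_coords:
  assumes "basis3 u v w"
  obtains a b c where "z = comb u v w a b c"
  using assms unfolding basis3_def by blast

text \<open>Both halves are Cramer's rule; the hypothesis is that the determinant does not vanish.\<close>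

lemma basis3_change:
  assumes B: "basis3 u v w"
    and det: "a1 * (b2 * c3 - b3 * c2) - a2 * (b1 * c3 - b3 * c1) + a3 * (b1 * c2 - b2 * c1) \<noteq> 0"
      (is "?d \<noteq> 0")
  shows "basis3 (comb u v w a1 a2 a3) (comb u v w b1 b2 b3) (comb u v w c1 c2 c3)"
proof -
  have eq: "comb (comb u v w a1 a2 a3) (comb u v w b1 b2 b3) (comb u v w c1 c2 c3) x y z
      = comb u v w (x * a1 + y * b1 + z * c1) (x * a2 + y * b2 + z * c2) (x * a3 + y * b3 + z * c3)"
    for x y z
    unfolding comb_def[of "comb _ _ _ _ _ _"] by (simp add: comb_simps)
  define D where "D = ?d"
  have D: "D \<noteq> 0" unfolding D_def by (rule det)
  have cramer: "x * D = 0" "y * D = 0" "z * D = 0"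
    if e: "x * a1 + y * b1 + z * c1 = 0" "x * a2 + y * b2 + z * c2 = 0"
      "x * a3 + y * b3 + z * c3 = 0" for x y z
  proof -
    have "x * D = (x * a1 + y * b1 + z * c1) * (b2 * c3 - b3 * c2)
        - (x * a2 + y * b2 + z * c2) * (b1 * c3 - b3 * c1)
        + (x * a3 + y * b3 + z * c3) * (b1 * c2 - b2 * c1)"
      unfolding D_def by (simp add: algebra_simps)
    thus "x * D = 0" unfolding e by simp
    have "y * D = (x * a1 + y * b1 + z * c1) * (c2 * a3 - c3 * a2)
        - (x * a2 + y * b2 + z * c2) * (c1 * a3 - c3 * a1)
        + (x * a3 + y * b3 + z * c3) * (c1 * a2 - c2 * a1)"
      unfolding D_def by (simp add: algebra_simps)
    thus "y * D = 0" unfolding e by simp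
    have "z * D = (x * a1 + y * b1 + z * c1) * (a2 * b3 - a3 * b2)
        - (x * a2 + y * b2 + z * c2) * (a1 * b3 - a3 * b1)
        + (x * a3 + y * b3 + z * c3) * (a1 * b2 - a2 * b1)"
      unfolding D_def by (simp add: algebra_simps)
    thus "z * D = 0" unfolding e by simp
  qed
  have indep: "x = 0 \<and> y = 0 \<and> z = 0"
    if "x * a1 + y * b1 + z * c1 = 0" "x * a2 + y * b2 + z * c2 = 0" "x * a3 + y * b3 + z * c3 = 0"
    for x y z
    using cramer[OF that] D by simp
  have "\<exists>x y z. t = comb u v w (x * a1 + y * b1 + z * c1) (x * a2 + y * b2 + z * c2)
      (x * a3 + y * b3 + z * c3)" for t
  proof -
    obtain p q r where t: "t = comb u v w p q r" using B by (rule basis3_coords)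
    define x where "x = p * (b2 * c3 - b3 * c2) - q * (b1 * c3 - b3 * c1) + r * (b1 * c2 - b2 * c1)"
    define y where "y = p * (c2 * a3 - c3 * a2) - q * (c1 * a3 - c3 * a1) + r * (c1 * a2 - c2 * a1)"
    define z where "z = p * (a2 * b3 - a3 * b2) - q * (a1 * b3 - a3 * b1) + r * (a1 * b2 - a2 * b1)"
    have *: "x * a1 + y * b1 + z * c1 = p * D" "x * a2 + y * b2 + z * c2 = q * D"
      "x * a3 + y * b3 + z * c3 = r * D"
      unfolding x_def y_def z_def D_def by (simp_all add: algebra_simps)
    have scaled: "x / D * i + y / D * j + z / D * k = (x * i + y * j + z * k) / D" for i j k
      by (simp add: add_divide_distrib)
    show ?thesis
      by (rule exI[of _ "x / D"], rule exI[of _ "y / D"], rule exI[of _ "z / D"])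
        (simp only: scaled * t nonzero_mult_div_cancel_right[OF D])
  qed
  thus ?thesis
    unfolding basis3_def eq comb_eq_0_iff[OF B] using indep by blast
qed

lemma dim_3_finite_dimensional:
  assumes "dim UNIV = 3"
  obtains Bs where "finite_dimensional_vector_space smul Bs"
proof -
  obtain Bs where Bs: "independent Bs" "UNIV \<subseteq> span Bs" "card Bs = dim UNIV"
    by (rule basis_exists[of UNIV]) auto
  hence "finite Bs" using assms by (metis card.infinite zero_neq_numeral)
  with Bs have "finite_dimensional_vector_space smul Bs"
    by unfold_locales auto
  thus ?thesis by (rule that)
qed

lemma span_pair_iff: "z \<in> span {u, v} \<longleftrightarrow> (\<exists>a b. z = smul a u + smul b v)"
  unfolding span_breakdown_eq span_singleton
  by (auto simp: algebra_simps image_iff)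

lemma basis3_of_not_in_span:
  assumes dim: "dim UNIV = 3" and ne: "u \<noteq> 0"
    and v: "v \<notin> span {u}" and w: "w \<notin> span {u, v}"
  shows "basis3 u v w"
proof -
  obtain Bs where "finite_dimensional_vector_space smul Bs"
    using dim by (rule dim_3_finite_dimensional)
  then interpret F: finite_dimensional_vector_space smul Bs .
  have uv: "v \<noteq> u" using v by (auto intro: span_base)
  have uvw: "w \<noteq> u" "w \<noteq> v" using w by (auto intro: span_base)
  have ind: "independent {w, v, u}"
  proof (intro independent_insertI)
    show "w \<notin> span {v, u}" using w by (simp add: insert_commute)
    show "v \<notin> span {u}" by fact
    show "u \<notin> span {}" using ne by simp
    show "independent {}" by (rule independent_empty)
  qed
  have "card {w, v, u} = 3" using uv uvw by simp
  hence spans: "span {w, v, u} = UNIV"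
    using F.card_ge_dim_independent[of "{w, v, u}" UNIV] ind dim by (metis top.extremum_unique subset_UNIV order_refl)
  have "\<exists>a b c. z = comb u v w a b c" for z
  proof -
    have "z \<in> span (insert w {v, u})" using spans by simp
    then obtain c where "z - smul c w \<in> span {v, u}"
      unfolding span_breakdown_eq by blast
    hence "z - smul c w \<in> span {u, v}" by (simp add: insert_commute)
    then obtain a b where "z - smul c w = smul a u + smul b v"
      by (auto simp: span_pair_iff)
    thus ?thesis by (metis comb_def diff_eq_eq)
  qed
  moreover have "a = 0 \<and> b = 0 \<and> c = 0" if "comb u v w a b c = 0" for a b c
  proof -
    have c: "c = 0"
    proof (rule ccontr)
      assume "c \<noteq> 0"
      have "smul c w = - (smul a u + smul b v)"
        using minus_unique[OF that[unfolded comb_def]] by simp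
      moreover have "- (smul a u + smul b v) \<in> span {u, v}"
        by (intro span_neg span_add span_scale span_base) auto
      ultimately have "smul (inverse c) (smul c w) \<in> span {u, v}"
        by (simp only: span_scale)
      thus False using w \<open>c \<noteq> 0\<close> by simp
    qed
    have b: "b = 0"
    proof (rule ccontr)
      assume "b \<noteq> 0"
      have "smul a u + smul b v = 0"
        using that c by (simp add: comb_def)
      hence "smul b v = - smul a u"
        using minus_unique by metis
      moreover have "- smul a u \<in> span {u}"
        by (intro span_neg span_scale span_base) auto
      ultimately have "smul (inverse b) (smul b v) \<in> span {u}"
        by (simp only: span_scale)
      thus False using v \<open>b \<noteq> 0\<close> by simp
    qed
    from that b c ne show ?thesis by (simp add: comb_def)
  qed
  ultimately show ?thesis unfolding basis3_def by blast
qed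

lemma basis3_extend2:
  assumes dim: "dim UNIV = 3" and ne: "u \<noteq> 0" and v: "v \<notin> span {u}"
  obtains w where "basis3 u v w"
proof -
  have "span {u, v} \<noteq> UNIV"
  proof
    assume "span {u, v} = UNIV"
    hence "dim UNIV \<le> card {u, v}" using dim_le_card[of UNIV "{u, v}"] by simp
    also have "\<dots> \<le> 2" by (simp add: card_insert_if)
    finally show False using dim by simp
  qed
  then obtain w where "w \<notin> span {u, v}" by auto
  thus ?thesis using basis3_of_not_in_span[OF dim ne v] that by blast
qed

lemma basis3_extend1:
  assumes dim: "dim UNIV = 3" and ne: "u \<noteq> 0"
  obtains v w where "basis3 u v w"
proof -
  have "span {u} \<noteq> UNIV"
  proof
    assume "span {u} = UNIV"
    hence "dim UNIV \<le> card {u}" using dim_le_card[of UNIV "{u}"] by simp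
    thus False using dim by simp
  qed
  then obtain v where "v \<notin> span {u}" by auto
  thus ?thesis using basis3_extend2[OF dim ne] that by blast
qed

lemma basis3_if_independent:
  assumes dim: "dim UNIV = 3"
    and ind: "\<And>a b c. comb u v w a b c = 0 \<Longrightarrow> a = 0 \<and> b = 0 \<and> c = 0"
  shows "basis3 u v w"
proof (rule basis3_of_not_in_span[OF dim])
  show "u \<noteq> 0" using ind[of 1 0 0] by (auto simp: comb_def)
  show "v \<notin> span {u}"
  proof
    assume "v \<in> span {u}"
    then obtain k where "v = smul k u" by (auto simp: span_singleton)
    thus False using ind[of "- k" 1 0] by (simp add: comb_def)
  qed
  show "w \<notin> span {u, v}"
  proof
    assume "w \<in> span {u, v}"
    then obtain k l where "w = smul k u + smul l v" by (auto simp: span_pair_iff)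
    thus False using ind[of "- k" "- l" 1] by (simp add: comb_def)
  qed
qed

lemma four_vectors_dependent:
  assumes dim: "dim UNIV = 3"
  obtains p0 p1 p2 p3 where
    "smul p0 x0 + smul p1 x1 + smul p2 x2 + smul p3 x3 = 0" "\<not> (p0 = 0 \<and> p1 = 0 \<and> p2 = 0 \<and> p3 = 0)"
proof -
  consider "x0 = 0" | "x1 \<in> span {x0}" | "x2 \<in> span {x0, x1}" | "basis3 x0 x1 x2"
    using basis3_of_not_in_span[OF dim] by blast
  thus ?thesis
  proof cases
    case 1
    thus ?thesis using that[of 1 0 0 0] by simp
  next
    case 2
    then obtain k where "x1 = smul k x0" by (auto simp: span_singleton)
    thus ?thesis using that[of "- k" 1 0 0] by simp
  next
    case 3
    then obtain k l where "x2 = smul k x0 + smul l x1" by (auto simp: span_pair_iff)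
    thus ?thesis using that[of "- k" "- l" 1 0] by simp
  next
    case 4
    then obtain k l m where "x3 = comb x0 x1 x2 k l m" by (rule basis3_coords)
    thus ?thesis using that[of "- k" "- l" "- m" 1] by (simp add: comb_def)
  qed
qed

end

section \<open>Recognising the tables\<close>

definition classified ::
  "(complex \<Rightarrow> 'a::ab_group_add \<Rightarrow> 'a) \<Rightarrow> ('a \<Rightarrow> 'a \<Rightarrow> 'a) \<Rightarrow> bool" where
  "classified smul m \<longleftrightarrow> (\<exists>M \<in> {J_4_8, A_1_3_2, A_1_4_3, A_2_2} \<union> A_4_1 ` {0, 1/3, 1}
     \<union> range A_6_1 \<union> {A_7_2, A_8_1}. isomorphic_algebras smul m (*s) (table_mult M))"

sublocale complex_algebra \<subseteq> complex_space ..

context complex_algebra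
begin

lemma mul_zero_left [simp]: "mul 0 y = 0"
  using mult_scale_left[of 0 0 y] by simp

lemma mul_zero_right [simp]: "mul x 0 = 0"
  using mult_scale_right[of x 0 0] by simp

lemma mul_diff_left: "mul (x - y) z = mul x z - mul y z"
  using mult_add_left[of "x - y" y z] by simp

lemma mul_diff_right: "mul x (y - z) = mul x y - mul x z"
  using mult_add_right[of x "y - z" z] by simp

lemma mul_comb:
  "mul (comb u v w a b c) (comb u v w a' b' c') =
     smul (a * a') (mul u u) + smul (a * b') (mul u v) + smul (a * c') (mul u w)
   + smul (b * a') (mul v u) + smul (b * b') (mul v v) + smul (b * c') (mul v w)
   + smul (c * a') (mul w u) + smul (c * b') (mul w v) + smul (c * c') (mul w w)"
  by (simp add: comb_def mult_add_left mult_add_right mult_scale_left mult_scale_right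
      scale_right_distrib algebra_simps)

lemma basis_table_isomorphic:
  assumes B: "basis3 u v w"
    and "mul u u = comb u v w (M$1$1$1) (M$1$1$2) (M$1$1$3)"
    and "mul u v = comb u v w (M$1$2$1) (M$1$2$2) (M$1$2$3)"
    and "mul u w = comb u v w (M$1$3$1) (M$1$3$2) (M$1$3$3)"
    and "mul v u = comb u v w (M$2$1$1) (M$2$1$2) (M$2$1$3)"
    and "mul v v = comb u v w (M$2$2$1) (M$2$2$2) (M$2$2$3)"
    and "mul v w = comb u v w (M$2$3$1) (M$2$3$2) (M$2$3$3)"
    and "mul w u = comb u v w (M$3$1$1) (M$3$1$2) (M$3$1$3)"
    and "mul w v = comb u v w (M$3$2$1) (M$3$2$2) (M$3$2$3)"
    and "mul w w = comb u v w (M$3$3$1) (M$3$3$2) (M$3$3$3)"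
  shows "isomorphic_algebras smul mul (*s) (table_mult M)"
proof -
  define g where "g x = comb u v w (x$1) (x$2) (x$3)" for x :: "complex^3"
  have inj: "inj g"
    by (rule injI) (simp add: g_def comb_eq_iff[OF B] vec_eq_iff forall_3)
  have surj: "\<exists>x. z = g x" for z
  proof -
    obtain a b c where z: "z = comb u v w a b c" using B by (rule basis3_coords)
    have "z = g (vector [a, b, c])" by (simp add: g_def z)
    thus ?thesis ..
  qed
  have bij: "bij g" unfolding bij_def surj_def using inj surj by blast
  have add: "g (x + y) = g x + g y" and sc: "g (k *s x) = smul k (g x)" for x y k
    by (simp_all add: g_def comb_simps)
  have mu: "g (table_mult M x y) = mul (g x) (g y)" for x y
    unfolding g_def mul_comb assms(2-) comb_simps
    by (simp add: comb_eq_iff[OF B] table_mult_def sum_3 algebra_simps)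
  have gi: "g (inv g z) = z" "inv g (g x) = x" for x z
    using bij by (simp_all add: bij_is_surj surj_f_inv_f bij_is_inj)
  have "algebra_isomorphism smul mul (*s) (table_mult M) (inv g)"
    unfolding algebra_isomorphism_def Vector_Spaces.linear_iff
  proof (intro conjI allI)
    show "vector_space smul" by (rule vector_space_axioms)
    show "vector_space ((*s) :: complex \<Rightarrow> complex^3 \<Rightarrow> complex^3)" by (rule vec.vector_space_axioms)
    show "bij (inv g)" using bij by (rule bij_imp_bij_inv)
    show "inv g (x + y) = inv g x + inv g y" for x y by (metis add gi)
    show "inv g (smul k x) = k *s inv g x" for x k by (metis sc gi)
    show "inv g (mul x y) = table_mult M (inv g x) (inv g y)" for x y by (metis mu gi)
  qed
  thus ?thesis unfolding isomorphic_algebras_def by blast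
qed

text \<open>Rescaling \<open>w\<close> turns the products \<open>u v\<close> and \<open>v u\<close> into \<open>(1 + s) w\<close> and \<open>(1 - s) w\<close>, which is
  possible exactly because \<open>a + b\<close> does not vanish. The principal root of \<open>s\<^sup>2\<close> may be \<open>-s\<close>; then
  the two isotropic vectors change places.\<close>

lemma classified_zero_diagonal_form:
  assumes B: "basis3 u v w" and ann: "\<And>t. mul w t = 0" "\<And>t. mul t w = 0"
    and uu: "mul u u = 0" and vv: "mul v v = 0"
    and uv: "mul u v = smul a w" and vu: "mul v u = smul b w" and ab: "a + b \<noteq> 0"
  shows "classified smul mul"
proof -
  define h where "h = (a + b) / 2"
  define s where "s = (a - b) / (a + b)"
  have h: "h \<noteq> 0" using ab by (simp add: h_def)
  have a: "a = (1 + s) * h" and b: "b = (1 - s) * h"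
  proof -
    have "s * (a + b) = a - b" using ab by (simp add: s_def)
    hence "(1 + s) * (a + b) = 2 * a" "(1 - s) * (a + b) = 2 * b"
      by (simp_all only: distrib_right left_diff_distrib) simp_all
    thus "a = (1 + s) * h" "b = (1 - s) * h" by (simp_all add: h_def)
  qed
  have "csqrt (s\<^sup>2) = s \<or> csqrt (s\<^sup>2) = - s"
    by (metis power2_csqrt power2_eq_iff)
  hence "isomorphic_algebras smul mul (*s) (table_mult (A_6_1 (s\<^sup>2)))"
  proof
    assume root: "csqrt (s\<^sup>2) = s"
    have "basis3 (comb u v w 1 0 0) (comb u v w 0 1 0) (comb u v w 0 0 h)"
      by (rule basis3_change[OF B]) (simp add: h)
    hence B': "basis3 u v (smul h w)" by (simp add: comb_def)
    show ?thesis
      by (rule basis_table_isomorphic[OF B'])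
        (simp_all add: A_6_1_def root axis_def comb_def ann uu vv uv vu mult_scale_left
          mult_scale_right a b)
  next
    assume root: "csqrt (s\<^sup>2) = - s"
    have "basis3 (comb u v w 0 1 0) (comb u v w 1 0 0) (comb u v w 0 0 h)"
      by (rule basis3_change[OF B]) (simp add: h)
    hence B': "basis3 v u (smul h w)" by (simp add: comb_def)
    show ?thesis
      by (rule basis_table_isomorphic[OF B'])
        (simp_all add: A_6_1_def root axis_def comb_def ann uu vv uv vu mult_scale_left
          mult_scale_right a b)
  qed
  thus ?thesis unfolding classified_def by blast
qed

text \<open>The product is a bilinear form on the plane of \<open>u\<close> and \<open>v\<close>, with matrix \<open>p q r s\<close>. If its symmetric
  part is nondegenerate, the plane has a basis of isotropic vectors, which
  \<open>classified_zero_diagonal_form\<close> handles. If the symmetric part is degenerate, the last hypothesis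
  makes the form itself symmetric of rank at most one, which is \<open>A_7_2\<close> or \<open>A_8_1\<close>.\<close>

lemma classified_bilinear_form:
  assumes B: "basis3 u v w" and ann: "\<And>t. mul w t = 0" "\<And>t. mul t w = 0"
    and uu: "mul u u = smul p w" and uv: "mul u v = smul q w"
    and vu: "mul v u = smul r w" and vv: "mul v v = smul s w"
    and sym: "4 * p * s = (q + r)\<^sup>2 \<Longrightarrow> q = r"
  shows "classified smul mul"
proof (cases "4 * p * s = (q + r)\<^sup>2")
  case False
  have mulE: "mul (comb u v w a b c) (comb u v w a' b' c')
      = smul (a * a' * p + a * b' * q + b * a' * r + b * b' * s) w" for a b c a' b' c'
    by (simp add: mul_comb ann uu uv vu vv scale_left_distrib)
  show ?thesis
  proof (cases "p = 0")
    case True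
    have t: "q + r \<noteq> 0" using False True by simp
    \<comment> \<open>With \<open>p = 0\<close> the quadratic form is \<open>y ((q + r) x + s y)\<close>: these are its two zero lines.\<close>
    let ?u = "comb u v w 1 0 0" and ?v = "comb u v w (- s) (q + r) 0"
    have "basis3 ?u ?v (comb u v w 0 0 1)"
      by (rule basis3_change[OF B]) (simp add: t)
    hence B': "basis3 ?u ?v w" by (simp only: comb_unit)
    show ?thesis
    proof (rule classified_zero_diagonal_form[OF B' ann])
      show "mul ?u ?u = 0" "mul ?v ?v = 0" by (simp_all add: mulE True algebra_simps)
      show "mul ?u ?v = smul ((q + r) * q) w" "mul ?v ?u = smul ((q + r) * r) w"
        by (simp_all add: mulE True)
      show "(q + r) * q + (q + r) * r \<noteq> 0"
        unfolding distrib_left[symmetric] using t by simp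
    qed
  next
    case p: False
    \<comment> \<open>The two roots of \<open>p X\<^sup>2 + (q + r) X + s\<close> give the isotropic vectors \<open>x u + v\<close> and \<open>y u + v\<close>.\<close>
    define d where "d = csqrt ((q + r)\<^sup>2 - 4 * p * s)"
    have d2: "d * d = (q + r)\<^sup>2 - 4 * p * s"
      by (simp add: d_def flip: power2_eq_square)
    have d0: "d \<noteq> 0" using False by (simp add: d_def)
    define x where "x = (d - (q + r)) / (2 * p)"
    define y where "y = (- d - (q + r)) / (2 * p)"
    have xy: "x - y = d / p" "x + y = - (q + r) / p"
      using p by (simp_all add: x_def y_def field_simps)
    have prod: "x * y = s / p"
    proof -
      have "x * y = ((q + r)\<^sup>2 - d * d) / (4 * p * p)"
        by (simp add: x_def y_def algebra_simps power2_eq_square)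
      thus ?thesis unfolding d2 using p by simp
    qed
    have vieta: "p * (x + y) = - (q + r)" "p * (x * y) = s"
      using p by (simp_all add: xy prod)
    have rx: "x * x * p + x * q + x * r + s = 0"
    proof -
      have "x * x * p + x * q + x * r + s = x * (p * (x + y) + (q + r)) - (p * (x * y) - s)"
        by (simp add: algebra_simps)
      thus ?thesis unfolding vieta by simp
    qed
    have ry: "y * y * p + y * q + y * r + s = 0"
    proof -
      have "y * y * p + y * q + y * r + s = y * (p * (x + y) + (q + r)) - (p * (x * y) - s)"
        by (simp add: algebra_simps)
      thus ?thesis unfolding vieta by simp
    qed
    have "x \<noteq> y" using xy(1) d0 p by auto
    let ?u = "comb u v w x 1 0" and ?v = "comb u v w y 1 0"
    have "basis3 ?u ?v (comb u v w 0 0 1)"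
      by (rule basis3_change[OF B]) (simp add: \<open>x \<noteq> y\<close>)
    hence B': "basis3 ?u ?v w" by (simp only: comb_unit)
    have "(x * y * p + x * q + y * r + s) + (y * x * p + y * q + x * r + s)
        = 2 * p * (x * y) + (q + r) * (x + y) + 2 * s"
      by (simp add: algebra_simps)
    also have "\<dots> = - (d * d) / p"
      unfolding xy prod d2 using p by (simp add: field_simps power2_eq_square)
    finally have "(x * y * p + x * q + y * r + s) + (y * x * p + y * q + x * r + s) \<noteq> 0"
      using d0 p by simp
    thus ?thesis
      by (intro classified_zero_diagonal_form[OF B' ann, of "x * y * p + x * q + y * r + s"
            "y * x * p + y * q + x * r + s"])
        (simp_all add: mulE rx ry)
  qed
next
  case True
  with sym have qr: "q = r" by simp
  have ps: "p * s = q * q" using True qr by (simp add: power2_eq_square)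
  show ?thesis
  proof (cases "p = 0")
    case p0: True
    hence q0: "q = 0" using ps by simp
    show ?thesis
    proof (cases "s = 0")
      case True
      have "isomorphic_algebras smul mul (*s) (table_mult A_8_1)"
        by (rule basis_table_isomorphic[OF B])
          (simp_all add: A_8_1_def comb_def ann uu uv vu vv True p0 q0 qr[symmetric])
      thus ?thesis unfolding classified_def by blast
    next
      case False
      have "basis3 (comb u v w 1 0 0) (comb u v w 0 1 0) (comb u v w 0 0 s)"
        by (rule basis3_change[OF B]) (simp add: False)
      hence B': "basis3 u v (smul s w)" by (simp add: comb_def)
      have "isomorphic_algebras smul mul (*s) (table_mult A_7_2)"
        by (rule basis_table_isomorphic[OF B'])
          (simp_all add: A_7_2_def axis_def comb_def ann uu uv vu vv p0 q0 qr[symmetric]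
            mult_scale_left mult_scale_right)
      thus ?thesis unfolding classified_def by blast
    qed
  next
    case False
    have mulE: "mul (comb u v w a b c) (comb u v w a' b' c')
        = smul (a * a' * p + a * b' * q + b * a' * r + b * b' * s) w" for a b c a' b' c'
      by (simp add: mul_comb ann uu uv vu vv scale_left_distrib)
    \<comment> \<open>The vector \<open>p v - q u\<close> spans the radical of the form.\<close>
    have "basis3 (comb u v w (- q) p 0) (comb u v w 1 0 0) (comb u v w 0 0 p)"
      by (rule basis3_change[OF B]) (simp add: False)
    hence B': "basis3 (comb u v w (- q) p 0) (comb u v w 1 0 0) (smul p w)"
      by (simp add: comb_def)
    have "isomorphic_algebras smul mul (*s) (table_mult A_7_2)"
      by (rule basis_table_isomorphic[OF B'])
        (use ps in \<open>simp_all add: A_7_2_def axis_def comb_def[of _ _ "smul p w"] mulE ann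
          mult_scale_left mult_scale_right qr[symmetric] algebra_simps\<close>)
    thus ?thesis unfolding classified_def by blast
  qed
qed

text \<open>A form of rank one satisfies the symmetry hypothesis of \<open>classified_bilinear_form\<close>: its symmetric part
  is degenerate only if the two linear factors are proportional.\<close>

lemma classified_rank_one:
  assumes B: "basis3 u v w" and ann: "\<And>t. mul w t = 0" "\<And>t. mul t w = 0"
    and mul: "\<And>x y. mul x y = smul (f x * g y) w"
  shows "classified smul mul"
proof (rule classified_bilinear_form[OF B ann mul mul mul mul])
  assume "4 * (f u * g u) * (f v * g v) = (f u * g v + f v * g u)\<^sup>2"
  hence "(f u * g v - f v * g u) * (f u * g v - f v * g u) = 0"
    by (simp add: power2_eq_square algebra_simps)
  thus "f u * g v = f v * g u" by simp
qed

end


section \<open>Power associativity and Peirce decomposition\<close>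

context jordan_algebra
begin

text \<open>The linearised Jordan identity, solved for multiplication by a product \<open>(a \<circ> b) \<circ> c\<close>. In this form
  it expresses multiplication by higher powers through multiplication by lower ones.\<close>

lemma jordan_operator:
  "mul (mul (mul a b) c) u = mul (mul a b) (mul c u) + mul (mul b c) (mul a u)
     + mul (mul c a) (mul b u) - mul a (mul c (mul b u)) - mul b (mul c (mul a u))"
proof -
  have "mul (mul a c) (mul b u) + mul (mul b c) (mul a u) + mul (mul a b) (mul c u)
      = mul (mul (mul a b) c) u + mul a (mul c (mul b u)) + mul b (mul c (mul a u))"
    using jordan_linearized[of a b u c]
    by (simp add: commute add_ac)
  thus ?thesis by (simp add: commute[of c a] algebra_simps)
qed

text \<open>Without a unit there is no zeroth power, so the index is shifted: \<open>jpow b n\<close> is \<open>b\<close> to the power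
  \<open>n + 1\<close>.\<close>

definition jpow :: "'a \<Rightarrow> nat \<Rightarrow> 'a" where
  "jpow b n = (mul b ^^ n) b"

lemma jpow_0 [simp]: "jpow b 0 = b"
  by (simp add: jpow_def)

lemma jpow_Suc: "jpow b (Suc n) = mul b (jpow b n)"
  by (simp add: jpow_def)

text \<open>By \<open>jordan_operator\<close>, multiplication by a power of \<open>b\<close> is a polynomial in multiplication by \<open>b\<close> and
  by \<open>b\<^sup>2\<close>, and these two commute by the Jordan identity itself.\<close>

lemma jpow_operators_commute:
  "mul (jpow b n) (mul b z) = mul b (mul (jpow b n) z) \<and>
   mul (jpow b n) (mul (mul b b) z) = mul (mul b b) (mul (jpow b n) z)"
proof (induction n arbitrary: z rule: less_induct)
  case (less n)
  have sq: "mul (mul b b) (mul b z) = mul b (mul (mul b b) z)" for z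
    by (metis commute jordan_identity)
  consider "n = 0" | "n = 1" | m where "n = Suc (Suc m)"
    by (metis One_nat_def nat.exhaust)
  thus ?case
  proof cases
    case 1
    thus ?thesis by (simp add: sq)
  next
    case 2
    thus ?thesis by (simp add: jpow_Suc sq)
  next
    case 3
    define p where "p = jpow b m"
    define q where "q = jpow b (Suc m)"
    have q: "q = mul b p" by (simp add: q_def p_def jpow_Suc)
    have pb: "mul p (mul b z) = mul b (mul p z)" "mul p (mul (mul b b) z) = mul (mul b b) (mul p z)" for z
      using less[of m z] 3 by (auto simp: p_def)
    have qb: "mul q (mul b z) = mul b (mul q z)" "mul q (mul (mul b b) z) = mul (mul b b) (mul q z)" for z
      using less[of "Suc m" z] 3 by (auto simp: q_def)
    have "jpow b n = mul b q" using 3 by (simp add: q_def jpow_Suc)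
    hence op: "mul (jpow b n) z = mul q (mul b z) + mul q (mul b z) + mul (mul b b) (mul p z)
        - mul b (mul b (mul p z)) - mul b (mul b (mul p z))" for z
      using jordan_operator[of b p b z]
      by (simp add: commute[of p b] commute[of q b] q[symmetric] pb)
    show ?thesis
      by (simp add: op pb qb sq mult_add_right mul_diff_right)
  qed
qed

text \<open>Power associativity: multiplication by \<open>b\<close> can be moved past multiplication by another power.\<close>

lemma jpow_mul: "mul (jpow b m) (jpow b n) = jpow b (Suc (m + n))"
proof (induction n)
  case 0
  show ?case by (simp add: jpow_Suc commute)
next
  case (Suc n)
  have "mul (jpow b m) (jpow b (Suc n)) = mul b (mul (jpow b m) (jpow b n))"
    using jpow_operators_commute[of b m "jpow b n"] by (simp add: jpow_Suc)
  thus ?case by (simp add: Suc jpow_Suc)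
qed

text \<open>For an element of square zero the operator identity for \<open>(v \<circ> v) \<circ> v\<close> retains only the cube of
  multiplication by \<open>v\<close>.\<close>

lemma square_zero_operator_cubed:
  assumes "mul v v = 0"
  shows "mul v (mul v (mul v t)) = 0"
proof -
  have "mul v (mul v (mul v t)) + mul v (mul v (mul v t)) = 0"
    using jordan_operator[of v v v t] by (simp add: assms) (metis add.right_inverse)
  hence "smul (1 + 1) (mul v (mul v (mul v t))) = 0"
    by (simp only: scale_left_distrib scale_one)
  thus ?thesis by simp
qed

lemma cube_zero_linearized:
  assumes cube: "\<And>a. mul a (mul a a) = 0"
  shows "mul d (mul a a) + smul 2 (mul a (mul a d)) = 0"
proof -
  let ?X = "mul d (mul a a) + mul a (mul a d) + mul a (mul a d)"
  have "mul (a + d) (mul (a + d) (a + d)) - mul (a - d) (mul (a - d) (a - d))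
      - mul d (mul d d) - mul d (mul d d) = ?X + ?X"
    by (simp add: mult_add_left mult_add_right mul_diff_left mul_diff_right commute[of d a])
  hence "?X + ?X = 0" by (simp add: cube)
  hence "smul (1 + 1) ?X = 0" by (simp only: scale_left_distrib scale_one)
  hence "?X = 0" by simp
  moreover have "smul 2 t = t + t" for t using scale_left_distrib[of 1 1 t] by simp
  ultimately show ?thesis by (simp add: add.assoc)
qed

lemma jpow_mul_assoc:
  assumes x: "x \<in> span (range (jpow b))" and y: "y \<in> span (range (jpow b))"
  shows "mul (mul x y) (jpow b n) = mul x (mul y (jpow b n))"
  using x
proof (induction rule: span_induct)
  case base
  show "subspace {x. mul (mul x y) (jpow b n) = mul x (mul y (jpow b n))}"
    by (simp add: subspace_def mult_add_left mult_scale_left)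
next
  case (step x)
  then obtain i where x: "x = jpow b i" by blast
  show ?case
    using y
  proof (induction rule: span_induct)
    case base
    show "subspace {y. mul (mul x y) (jpow b n) = mul x (mul y (jpow b n))}"
      by (simp add: subspace_def mult_add_left mult_scale_left mult_add_right mult_scale_right)
  next
    case (step y)
    thus ?case by (auto simp: x jpow_mul add_ac)
  qed
qed

lemma jpow_mul_filtration:
  assumes x: "x \<in> span (range (jpow b))" and y: "y \<in> span (jpow b ` {k..})"
  shows "mul x y \<in> span (jpow b ` {Suc k..})"
  using x
proof (induction rule: span_induct)
  case base
  show "subspace {x. mul x y \<in> span (jpow b ` {Suc k..})}"
    by (simp add: subspace_def mult_add_left mult_scale_left span_add span_scale span_zero)
next
  case (step x)
  then obtain i where x: "x = jpow b i" by blast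
  show ?case
    using y
  proof (induction rule: span_induct)
    case base
    show "subspace {y. mul x y \<in> span (jpow b ` {Suc k..})}"
      by (simp add: subspace_def mult_add_right mult_scale_right span_add span_scale span_zero)
  next
    case (step y)
    thus ?case by (auto simp: x jpow_mul intro!: span_base)
  qed
qed

text \<open>Four powers of \<open>b\<close> are linearly dependent. Solving a relation for the lowest power that occurs gives
  a combination \<open>v\<close> of powers that fixes all sufficiently high powers of \<open>b\<close>. Then \<open>v\<^sup>3\<close> is a combination of
  powers that it fixes, hence idempotent; if it is zero, the powers it fixes are zero too.\<close>

theorem nilpotent_if_no_idempotent:
  assumes dim: "dim UNIV = 3" and S: "subspace S" "b \<in> S"
    and closed: "\<And>x y. x \<in> S \<Longrightarrow> y \<in> S \<Longrightarrow> mul x y \<in> S"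
    and no_idem: "\<And>e. e \<in> S \<Longrightarrow> mul e e = e \<Longrightarrow> e = 0"
  shows "jpow b 3 = 0"
proof -
  let ?B = "jpow b"
  have BS: "?B n \<in> S" for n
    by (induction n) (simp_all add: jpow_Suc S closed)
  obtain p0 p1 p2 p3 where rel: "smul p0 (?B 0) + smul p1 (?B 1) + smul p2 (?B 2) + smul p3 (?B 3) = 0"
    and nz: "\<not> (p0 = 0 \<and> p1 = 0 \<and> p2 = 0 \<and> p3 = 0)"
    using four_vectors_dependent[OF dim] by blast
  have solve: "x = smul (- (1 / p)) y" if "p \<noteq> 0" "smul p x + y = 0" for p x y
  proof -
    have "smul p x = - y" using that by (simp add: add_eq_0_iff2)
    hence "smul (1 / p) (smul p x) = smul (1 / p) (- y)" by simp
    thus ?thesis using that by simp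
  qed
  consider "p0 = 0" "p1 = 0" "p2 = 0" "p3 \<noteq> 0"
    | k c1 c2 c3 where "k \<le> 2" "?B k = smul c1 (?B (k + 1)) + smul c2 (?B (k + 2)) + smul c3 (?B (k + 3))"
  proof -
    assume a: "p0 = 0 \<Longrightarrow> p1 = 0 \<Longrightarrow> p2 = 0 \<Longrightarrow> p3 \<noteq> 0 \<Longrightarrow> thesis"
      and b: "\<And>k c1 c2 c3. k \<le> 2 \<Longrightarrow>
        ?B k = smul c1 (?B (k + 1)) + smul c2 (?B (k + 2)) + smul c3 (?B (k + 3)) \<Longrightarrow> thesis"
    consider "p0 \<noteq> 0" | "p0 = 0" "p1 \<noteq> 0" | "p0 = 0" "p1 = 0" "p2 \<noteq> 0" | "p0 = 0" "p1 = 0" "p2 = 0" "p3 \<noteq> 0"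
      using nz by blast
    thus thesis
    proof cases
      case 1
      have "?B 0 = smul (- (1 / p0)) (smul p1 (?B 1) + smul p2 (?B 2) + smul p3 (?B 3))"
        using 1 by (rule solve) (use rel in \<open>simp add: add.assoc\<close>)
      thus thesis
        by (intro b[of 0 "- (1 / p0) * p1" "- (1 / p0) * p2" "- (1 / p0) * p3"])
          (simp_all add: scale_right_distrib numeral_3_eq_3 numeral_2_eq_2)
    next
      case 2
      have "?B 1 = smul (- (1 / p1)) (smul p2 (?B 2) + smul p3 (?B 3))"
        using 2(2) by (rule solve) (use rel 2(1) in \<open>simp add: add.assoc\<close>)
      thus thesis
        by (intro b[of 1 "- (1 / p1) * p2" "- (1 / p1) * p3" 0])
          (simp_all add: scale_right_distrib numeral_3_eq_3 numeral_2_eq_2)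
    next
      case 3
      have "?B 2 = smul (- (1 / p2)) (smul p3 (?B 3))"
        using 3(3) by (rule solve) (use rel 3(1,2) in \<open>simp add: add.assoc\<close>)
      thus thesis
        by (intro b[of 2 "- (1 / p2) * p3" 0 0])
          (simp_all add: scale_right_distrib numeral_3_eq_3 numeral_2_eq_2)
    next
      case 4
      thus thesis by (rule a)
    qed
  qed
  thus ?thesis
  proof cases
    case 1
    with rel show ?thesis by simp
  next
    case (2 k c1 c2 c3)
    define v where "v = smul c1 (?B 0) + smul c2 (?B 1) + smul c3 (?B 2)"
    have v_eq: "mul v (?B n) = smul c1 (?B (n + 1)) + smul c2 (?B (n + 2)) + smul c3 (?B (n + 3))" for n
      by (simp add: v_def mult_add_left mult_scale_left jpow_mul numeral_2_eq_2 numeral_3_eq_3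
          flip: jpow_Suc)
    have v_fix: "mul v (?B (k + n)) = ?B (k + n)" for n
    proof (induction n)
      case 0
      show ?case using v_eq[of k] 2(2) by simp
    next
      case (Suc n)
      have "mul v (?B (k + Suc n)) = mul b (mul v (?B (k + n)))"
        unfolding v_eq by (simp add: mult_add_right mult_scale_right flip: jpow_Suc)
      thus ?case using Suc by (simp add: jpow_Suc)
    qed
    have v2: "mul v (?B n) = ?B n" if "n \<ge> 2" for n
      using v_fix[of "n - k"] that 2(1) by simp
    have vS: "v \<in> span (?B ` {0..})"
      unfolding v_def by (intro span_add span_scale span_base imageI) simp_all
    have v: "v \<in> span (range ?B)" using vS by (simp add: atLeast_0)
    \<comment> \<open>The third power lies in the span of \<open>b\<^sup>3, b\<^sup>4, \<dots>\<close>, where \<open>v\<close> acts as the identity for every \<open>k \<le> 2\<close>.\<close>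
    define e where "e = mul v (mul v v)"
    have vv: "mul v v \<in> span (?B ` {Suc 0..})" using v vS by (rule jpow_mul_filtration)
    have vv': "mul v v \<in> span (range ?B)" using vv span_mono[of "?B ` {Suc 0..}" "range ?B"] by blast
    have e: "e \<in> span (?B ` {2..})"
      using jpow_mul_filtration[OF v vv] by (simp add: e_def numeral_2_eq_2)
    have eB: "mul e (?B n) = ?B n" if "n \<ge> 2" for n
      unfolding e_def jpow_mul_assoc[OF v vv'] jpow_mul_assoc[OF v v] v2[OF that] ..
    have "mul e x = x" if "x \<in> span (?B ` {2..})" for x
      using that
    proof (induction rule: span_induct)
      case base
      show "subspace {x. mul e x = x}"
        by (simp add: subspace_def mult_add_right mult_scale_right)
    next
      case (step x)
      thus ?case using eB by auto
    qed
    hence "mul e e = e" using e by blast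
    moreover have "v \<in> S"
      unfolding v_def using S BS by (intro subspace_add subspace_scale)
    hence "e \<in> S" unfolding e_def by (intro closed)
    ultimately have "e = 0" by (intro no_idem)
    thus "?B 3 = 0" using eB[of 3] by simp
  qed
qed

lemma peirce_idempotent_cubic:
  assumes "mul e e = e"
  shows "mul e z = smul 3 (mul e (mul e z)) - smul 2 (mul e (mul e (mul e z)))"
proof -
  have "smul 3 t = t + t + t" "smul 2 t = t + t" for t
    using scale_left_distrib[of 1 1 t] scale_left_distrib[of 2 1 t] by simp_all
  thus ?thesis using jordan_operator[of e e e z] by (simp add: assms diff_diff_eq)
qed

text \<open>By the cubic identity the eigenvalues of multiplication by \<open>e\<close> are among 1, 1/2 and 0; the three
  components are the corresponding Lagrange interpolation polynomials in that operator, applied to \<open>z\<close>.\<close>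

lemma peirce_decomposition:
  assumes e: "mul e e = e"
  obtains z1 zh z0 where "z = z1 + zh + z0"
    "mul e z1 = z1" "mul e zh = smul (1/2) zh" "mul e z0 = 0"
proof -
  let ?l = "mul e z" let ?l2 = "mul e ?l" let ?l3 = "mul e ?l2"
  have "c = b - a" if "a = b - c" for a b c :: 'a
    using that by (simp add: algebra_simps)
  from this[OF peirce_idempotent_cubic[OF e, of z]]
  have l3: "smul 2 ?l3 = smul 3 ?l2 - ?l" .
  hence "smul (1/2) (smul 2 ?l3) = smul (1/2) (smul 3 ?l2 - ?l)" by simp
  hence l3: "?l3 = smul (3/2) ?l2 - smul (1/2) ?l" by (simp add: scale_right_diff_distrib)
  define z1 where "z1 = smul 2 ?l2 - ?l"
  define zh where "zh = smul 4 ?l - smul 4 ?l2"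
  define z0 where "z0 = z - smul 3 ?l + smul 2 ?l2"
  show ?thesis
  proof (rule that[of z1 zh z0])
    have z: "z1 = comb z ?l ?l2 0 (- 1) 2" "zh = comb z ?l ?l2 0 4 (- 4)" "z0 = comb z ?l ?l2 1 (- 3) 2"
      by (simp_all add: z1_def zh_def z0_def comb_def)
    show "z = z1 + zh + z0" unfolding z by (simp add: comb_simps) (simp add: comb_def)
    have l: "mul e (comb z ?l ?l2 a b c) = comb z ?l ?l2 0 (a - c / 2) (b + 3 * c / 2)" for a b c
      by (simp add: comb_def mult_add_right mult_scale_right l3 scale_right_diff_distrib
          scale_left_distrib scale_left_diff_distrib)
    show "mul e z1 = z1" "mul e zh = smul (1/2) zh" "mul e z0 = 0"
      unfolding z l by (simp_all add: comb_simps) (simp_all add: comb_def)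
  qed
qed

text \<open>Multiplication by an element of \<open>J\<^sub>0(e)\<close> or \<open>J\<^sub>1(e)\<close> preserves every Peirce space: the
  linearised Jordan identity at \<open>e, e, x, y\<close> has a common factor \<open>1 - 2 i\<close>.\<close>

lemma peirce_product:
  assumes e: "mul e e = e" and x: "mul e x = smul i x" and y: "mul e y = smul j y" and "i \<noteq> 1/2"
  shows "mul e (mul x y) = smul j (mul x y)"
proof -
  have lin: "mul e (mul x y) + (smul (i * j) (mul x y) + smul (i * j) (mul x y))
      = smul j (mul x y) + (smul i (mul e (mul x y)) + smul i (mul e (mul x y)))"
    using jordan_linearized[of e e x y]
    by (simp add: e x y commute[of x e] mult_scale_left mult_scale_right add_ac
        mult.commute[of j i])
  have "X - (Q + Q) = Y - (P + P)" if "X + (P + P) = Y + (Q + Q)" for X Y P Q :: 'a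
    using that by (simp add: algebra_simps)
  from this[OF lin]
  have "smul (1 - (i + i)) (mul e (mul x y)) = smul (1 - (i + i)) (smul j (mul x y))"
    unfolding scale_left_diff_distrib scale_left_distrib[of i i] by simp
  moreover have "1 - (i + i) \<noteq> 0" using \<open>i \<noteq> 1/2\<close> by (simp add: field_simps)
  ultimately show ?thesis by (metis scale_cancel_left)
qed

text \<open>The product of two elements of \<open>J\<^sub>1\<^sub>/\<^sub>2(e)\<close> lies in \<open>J\<^sub>0(e) + J\<^sub>1(e)\<close>, where multiplication by
  \<open>e\<close> is idempotent.\<close>

lemma peirce_half_product:
  assumes e: "mul e e = e" and x: "mul e x = smul (1/2) x" and y: "mul e y = smul (1/2) y"
  shows "mul e (mul e (mul x y)) = mul e (mul x y)"
  using jordan_linearized[of e x y e]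
  by (simp add: e x y commute[of x e] commute[of y e] commute[of y x] commute[of "mul x y" e]
      mult_scale_left mult_scale_right algebra_simps)

lemma jordan_fourth_power: "mul (mul x x) (mul x x) = mul x (mul x (mul x x))"
  using jordan_identity[of x x] by (simp add: commute)

end


section \<open>Rota-Baxter operators in dimension three\<close>

locale rota_baxter_jordan3 = jordan_algebra +
  fixes R :: "'a \<Rightarrow> 'a"
  assumes dim3: "dim UNIV = 3"
    and rota_baxter: "rota_baxter_operator smul mul R"
begin

lemma R_add: "R (x + y) = R x + R y" and R_scale: "R (smul c x) = smul c (R x)"
  using rota_baxter by (simp_all add: rota_baxter_operator_def Vector_Spaces.linear_iff)

lemma R_zero [simp]: "R 0 = 0"
  using R_scale[of 0 0] by simp

lemma R_diff: "R (x - y) = R x - R y"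
  using R_add[of "x - y" y] by simp

lemma R_comb: "R (comb u v w a b c) = smul a (R u) + smul b (R v) + smul c (R w)"
  by (simp add: comb_def R_add R_scale)

lemma RB: "mul (R x) (R y) = R (mul (R x) y) + R (mul x (R y))"
  using rota_baxter by (simp add: rota_baxter_operator_def R_add)

lemma RB_square: "mul (R x) (R x) = smul 2 (R (mul x (R x)))"
proof -
  have "smul 2 t = t + t" for t using scale_left_distrib[of 1 1 t] by simp
  thus ?thesis using RB[of x x] by (simp add: commute[of "R x" x])
qed

lemma RB_coords:
  assumes "basis3 u v w"
    and "mul (R x) (R y) = comb u v w a b c"
    and "R (mul (R x) y) + R (mul x (R y)) = comb u v w a' b' c'"
  shows "a = a'" "b = b'" "c = c'"
  using RB[of x y] unfolding assms(2,3) comb_eq_iff[OF assms(1)] by simp_all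

sublocale ind: complex_algebra smul "induced_mult mul R"
  using induced_pre_jordan[OF rota_baxter] by (rule pre_jordan_algebra.axioms)

abbreviation "ind_classified \<equiv> classified smul (induced_mult mul R)"

section \<open>A nonzero idempotent in the range\<close>

text \<open>Here \<open>J\<^sub>1(e)\<close> is the line of \<open>e\<close> and \<open>J\<^sub>0(e) = 0\<close>, so power associativity makes all products in
  \<open>J\<^sub>1\<^sub>/\<^sub>2(e)\<close> vanish. The Rota-Baxter identity then forces \<open>R e = 0\<close> and \<open>R z\<close> to be a multiple of \<open>e\<close>,
  and subtracting a multiple of \<open>x\<close> from \<open>z\<close> moves \<open>z\<close> into the kernel.\<close>

lemma classified_third_peirce_half:
  assumes B: "basis3 e x z" and ee: "mul e e = e" and ex: "mul e x = smul (1/2) x"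
    and ez: "mul e z = smul (1/2) z" and Rx: "R x = e"
  shows ind_classified
proof -
  let ?E = "comb e x z"
  \<comment> \<open>An opaque name for one half keeps fractions out of the polynomial identities.\<close>
  define h :: complex where "h = 1/2"
  have h: "h + h = 1" "h \<noteq> 0" by (simp_all add: h_def)
  have half_sq: "\<exists>k. mul u v = smul k e"
    if "mul e u = smul (1/2) u" "mul e v = smul (1/2) v" for u v
  proof -
    obtain a b c where uv: "mul u v = ?E a b c" using B by (rule basis3_coords)
    have m: "mul e (?E a b c) = ?E a (b/2) (c/2)" for a b c
      by (simp add: comb_def mult_add_right mult_scale_right ee ex ez)
    from peirce_half_product[OF ee that] have "b = 0 \<and> c = 0"
      unfolding uv m comb_eq_iff[OF B] by simp
    thus ?thesis using uv by (auto simp: comb_def)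
  qed
  have null: "mul u u = 0" if u: "mul e u = smul (1/2) u" for u
  proof -
    obtain k where k: "mul u u = smul k e" using half_sq[OF u u] by blast
    have "mul (mul u u) (mul u u) = smul (k * k) e"
      by (simp add: k mult_scale_left mult_scale_right ee)
    moreover have "mul u (mul u (mul u u)) = smul (k * k / 2) e"
      by (simp add: k mult_scale_left mult_scale_right commute[of u e] u)
    ultimately have "smul (k * k) e = smul (k * k / 2) e"
      using jordan_fourth_power[of u] by simp
    moreover have "e \<noteq> 0" using comb_eq_0_iff[OF B, of 1 0 0] by (simp add: comb_def)
    ultimately have "k = 0" by (simp add: scale_cancel_right)
    thus ?thesis using k by simp
  qed
  have xx: "mul x x = 0" and zz: "mul z z = 0" using ex ez by (simp_all add: null)
  have "mul (x + z) (x + z) = 0"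
    by (rule null) (simp add: mult_add_right ex ez scale_right_distrib)
  hence "smul 2 (mul x z) = 0"
    using scale_left_distrib[of 1 1 "mul x z"]
    by (simp add: mult_add_left mult_add_right xx zz commute[of z x])
  hence xz: "mul x z = 0" by simp
  obtain a b c where Re: "R e = ?E a b c" using B by (rule basis3_coords)
  obtain a' b' c' where Rz: "R z = ?E a' b' c'" using B by (rule basis3_coords)
  have mulE: "mul (?E p q r) (?E p' q' r') = ?E (p * p') (h * (p * q' + q * p')) (h * (p * r' + r * p'))"
    for p q r p' q' r'
    by (simp add: mul_comb ee ex ez xx zz xz commute[of x e] commute[of z e] commute[of z x] h_def)
      (simp add: comb_def algebra_simps scale_left_distrib add_divide_distrib)
  have RE: "R (?E p q r) = ?E (p * a + q + r * a') (p * b + r * b') (p * c + r * c')" for p q r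
    by (simp add: R_comb Re Rx Rz) (simp add: comb_def algebra_simps scale_left_distrib)
  note mulE1 = mulE[of 1 0 0, unfolded comb_unit] mulE[of 0 1 0, unfolded comb_unit]
    mulE[of _ _ _ 1 0 0, unfolded comb_unit]
  have "mul (R x) (R e) = ?E a (h * b) (h * c)"
    unfolding Rx Re by (simp add: mulE1)
  moreover have "R (mul (R x) e) + R (mul x (R e)) = ?E (a + h * a) b c"
    unfolding Rx Re ee by (simp add: mulE1 RE Re comb_simps)
  ultimately have "a = a + h * a" "h * b = b" "h * c = c" by (rule RB_coords[OF B])+
  hence abc: "a = 0" "b = 0" "c = 0" using h by (simp_all add: h_def)
  hence Re0: "R e = 0" using Re by (simp add: comb_zero)
  have "mul (R z) (R e) = ?E 0 0 0" by (simp add: Re0 comb_zero)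
  moreover have "R (mul (R z) e) + R (mul z (R e))
      = ?E (h * b' + h * c' * a') (h * c' * b') (h * c' * c')"
    unfolding Re0 Rz by (simp add: mulE1 RE abc)
  ultimately have "0 = h * b' + h * c' * a'" "0 = h * c' * c'" by (rule RB_coords[OF B])+
  hence bc': "c' = 0" "b' = 0" using h by auto
  define y where "y = ?E 0 (- a') 1"
  have y: "mul e y = smul (1/2) y" 
    by (simp add: y_def comb_def mul_diff_right mult_add_right mult_scale_right ex ez
        scale_right_diff_distrib)
  have Ry: "R y = 0" by (simp add: y_def RE abc bc' comb_zero)
  have "basis3 (?E 0 2 0) (?E 0 (- a') 1) (?E 1 0 0)" by (rule basis3_change[OF B]) simp
  hence B': "basis3 (smul 2 x) y e" by (simp add: y_def comb_def)
  have "isomorphic_algebras smul (induced_mult mul R) (*s) (table_mult J_4_8)"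
    by (rule ind.basis_table_isomorphic[OF B'])
      (simp_all add: J_4_8_def axis_def comb_def induced_mult_def R_scale Rx Ry Re0 ee ex y
        mult_scale_left mult_scale_right)
  thus ?thesis unfolding classified_def by blast
qed

text \<open>The Peirce rules leave \<open>x \<circ> x = s e + t z\<close>, \<open>x \<circ> z = n x\<close> and \<open>z \<circ> z = m z\<close>. The Rota-Baxter
  equations show that \<open>R e = 0\<close> and that \<open>R z = c' z\<close>, where \<open>c' = 0\<close> unless \<open>n = m = 0\<close>. Either way
  \<open>R z\<close> annihilates the algebra.\<close>

lemma classified_third_peirce_zero:
  assumes B: "basis3 e x z" and ee: "mul e e = e" and ex: "mul e x = smul (1/2) x"
    and ez: "mul e z = 0" and Rx: "R x = e"
  shows ind_classified
proof -
  let ?E = "comb e x z"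
  define h :: complex where "h = 1/2"
  have h: "h + h = 1" "h \<noteq> 0" by (simp_all add: h_def)
  have xe: "mul x e = smul (1/2) x" and ze: "mul z e = 0" by (simp_all add: commute[of _ e] ex ez)
  have lE: "mul e (?E a b c) = ?E a (b / 2) 0" for a b c
    by (simp add: comb_def mult_add_right mult_scale_right ee ex ez)
  obtain s s' t where xx: "mul x x = ?E s s' t" using B by (rule basis3_coords)
  from peirce_half_product[OF ee ex ex] have "s' = 0"
    unfolding xx lE comb_eq_iff[OF B] by simp
  note xx = xx[unfolded this]
  obtain n1 n n2 where zx: "mul z x = ?E n1 n n2" using B by (rule basis3_coords)
  have "mul e (mul z x) = smul (1/2) (mul z x)" by (rule peirce_product[OF ee _ ex, of z 0]) (simp_all add: ez)
  hence "n1 = 0 \<and> n2 = 0" unfolding zx lE comb_scale comb_eq_iff[OF B] by simp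
  hence zx: "mul z x = ?E 0 n 0" using zx by simp
  hence xz: "mul x z = ?E 0 n 0" by (simp add: commute)
  obtain m1 m2 m where zz: "mul z z = ?E m1 m2 m" using B by (rule basis3_coords)
  have "mul e (mul z z) = smul 0 (mul z z)" by (rule peirce_product[OF ee, of z 0]) (simp_all add: ez)
  hence "m1 = 0 \<and> m2 = 0" unfolding zz lE comb_scale comb_eq_iff[OF B] by simp
  hence zz: "mul z z = ?E 0 0 m" using zz by simp
  obtain a b c where Re: "R e = ?E a b c" using B by (rule basis3_coords)
  obtain a' b' c' where Rz: "R z = ?E a' b' c'" using B by (rule basis3_coords)
  have mulE: "mul (?E p q r) (?E p' q' r')
      = ?E (p * p' + s * q * q') (h * (p * q' + q * p') + n * (q * r' + r * q')) (t * q * q' + m * r * r')"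
    for p q r p' q' r'
    by (simp add: mul_comb ee ex ez xe ze xx zz xz zx h_def)
      (simp add: comb_def algebra_simps scale_left_distrib add_divide_distrib)
  have RE: "R (?E p q r) = ?E (p * a + q + r * a') (p * b + r * b') (p * c + r * c')" for p q r
    by (simp add: R_comb Re Rx Rz) (simp add: comb_def algebra_simps scale_left_distrib)
  note mulE1 = mulE[of 1 0 0, unfolded comb_unit] mulE[of _ _ _ 1 0 0, unfolded comb_unit]
    mulE[of 0 1 0, unfolded comb_unit] mulE[of _ _ _ 0 1 0, unfolded comb_unit]
    mulE[of 0 0 1, unfolded comb_unit] mulE[of _ _ _ 0 0 1, unfolded comb_unit]
  have pow: "s * s = s * (h * s + n * t)"
  proof -
    have "mul (mul x x) (mul x x) = ?E (s * s) 0 (m * t * t)"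
      by (simp add: xx mulE)
    moreover have "mul x (mul x (mul x x)) = ?E (s * (h * s + n * t)) 0 (t * (h * s + n * t))"
      by (simp add: xx mulE1)
    ultimately show ?thesis using jordan_fourth_power[of x] by (auto simp: comb_eq_iff[OF B])
  qed
  have "mul (R x) (R e) = ?E a (h * b) 0"
    by (simp add: Rx Re mulE1)
  moreover have "R (mul (R x) e) + R (mul x (R e)) = ?E (a + a * s * b + h * a + n * c + a' * t * b)
     (b + b * s * b + b' * t * b) (c + c * s * b + c' * t * b)"
    by (simp add: Rx Re ee mulE1 RE comb_simps) (simp add: comb_eq_iff[OF B] algebra_simps)
  ultimately have xe1: "a = a + a * s * b + h * a + n * c + a' * t * b"
    and xe2: "h * b = b + b * s * b + b' * t * b"
    and xe3: "0 = c + c * s * b + c' * t * b" by (rule RB_coords[OF B])+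
  have "mul (R x) (R z) = ?E a' (h * b') 0"
    by (simp add: Rx Rz mulE1)
  moreover have "R (mul (R x) z) + R (mul x (R z)) = ?E (a * s * b' + h * a' + n * c' + a' * t * b')
     (b * s * b' + b' * t * b') (c * s * b' + c' * t * b')"
    by (simp add: Rx Rz ez mulE1 RE comb_simps) (simp add: comb_eq_iff[OF B] algebra_simps)
  ultimately have xz1: "a' = a * s * b' + h * a' + n * c' + a' * t * b'"
    and xz2: "h * b' = b * s * b' + b' * t * b'"
    and xz3: "0 = c * s * b' + c' * t * b'" by (rule RB_coords[OF B])+
  have "mul (R e) (R e) = ?E (a * a + s * b * b) (a * b + 2 * n * b * c) (t * b * b + m * c * c)"
    by (simp add: Re mulE) (simp add: comb_eq_iff[OF B] h_def)
  moreover have "R (mul (R e) e) + R (mul e (R e)) = ?E (2 * a * a + b) (2 * a * b) (2 * a * c)"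
    by (simp add: Re mulE1 RE comb_simps) (simp add: comb_eq_iff[OF B] h_def algebra_simps)
  ultimately have ee1: "a * a + s * b * b = 2 * a * a + b"
    and ee2: "a * b + 2 * n * b * c = 2 * a * b"
    by (rule RB_coords[OF B])+
  have "mul (R e) (R z) = ?E (a * a' + s * b * b') (h * (a * b' + b * a') + n * (b * c' + c * b'))
      (t * b * b' + m * c * c')"
    by (simp add: Re Rz mulE)
  moreover have "R (mul (R e) z) + R (mul e (R z)) = ?E (a * a' + n * b + h * b' + a' * m * c)
      (b * a' + b' * m * c) (c * a' + c' * m * c)"
    by (simp add: Re Rz mulE1 RE comb_simps) (simp add: comb_eq_iff[OF B] algebra_simps)
  ultimately have ez1: "a * a' + s * b * b' = a * a' + n * b + h * b' + a' * m * c"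
    by (rule RB_coords[OF B])+
  have b': "b' = 0"
  proof (rule ccontr)
    assume nz: "b' \<noteq> 0"
    have "b' * h = b' * (s * b + t * b')" using xz2 by (simp add: algebra_simps)
    hence hs: "h = s * b + t * b'" using nz by simp
    have "b * h = b + b * (s * b + t * b')" using xe2 by (simp add: algebra_simps)
    hence b: "b = 0" unfolding hs[symmetric] by simp
    hence "t * b' \<noteq> 0" using hs h by simp
    moreover have c: "c = 0" using xe3 b by simp
    ultimately have "c' = 0" using xz3 by auto
    have "h * a = 0" using xe1 b c by simp
    hence "a = 0" using h by simp
    hence "h * b' = 0" using ez1 b c by simp
    thus False using nz h by simp
  qed
  have "mul (R z) (R z) = ?E (a' * a') 0 (m * c' * c')"
    by (simp add: Rz mulE b')
  moreover have "R (mul (R z) z) + R (mul z (R z)) = ?E (2 * a' * m * c') 0 (2 * c' * m * c')"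
    by (simp add: Rz mulE1 RE comb_simps b') (simp add: comb_eq_iff[OF B])
  ultimately have zz1: "a' * a' = 2 * a' * m * c'" and zz3: "m * c' * c' = 2 * c' * m * c'"
    by (rule RB_coords[OF B])+
  have nc': "n * c' = h * a'"
  proof -
    have "a' = h * a' + n * c'" using xz1 b' by simp
    moreover have "a' = h * a' + h * a'" using h(1) by (metis distrib_right mult_1)
    ultimately show ?thesis by (metis add_left_cancel)
  qed
  have mc': "m * c' = 0" using zz3 by auto
  hence a': "a' = 0" using zz1 by auto
  hence nc0: "n * c' = 0" using nc' by simp
  have b: "b = 0"
  proof (rule ccontr)
    assume nz: "b \<noteq> 0"
    have "b * h = b * (1 + s * b)" using xe2 b' by (simp add: algebra_simps)
    hence sb: "h = 1 + s * b" using nz by simp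
    hence s: "s \<noteq> 0" by (auto simp: h_def)
    hence "s = h * s + n * t" using pow by simp
    hence "(h + h) * s = h * s + n * t" using h by simp
    hence st: "h * s = n * t" by (simp add: algebra_simps)
    hence n: "n \<noteq> 0" "t \<noteq> 0" using s h by auto
    hence c': "c' = 0" using nc0 by simp
    have "0 = c * (1 + s * b)" using xe3 c' by (simp add: algebra_simps)
    hence c: "c = 0" using sb h by simp
    have "b * a = 0" using ee2 c by simp
    hence "a = 0" using nz by simp
    hence "b * (s * b) = b" using ee1 by simp
    hence "s * b = 1" using nz by simp
    thus False using sb by (simp add: h_def)
  qed
  have c: "c = 0" using xe3 b by simp
  have "h * a = 0" using xe1 b c by simp
  hence a: "a = 0" using h by simp
  have Re0: "R e = 0" using Re a b c by (simp add: comb_zero)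
  have Rz': "R z = smul c' z" using Rz a' b' by (simp add: comb_def)
  have kill: "mul (R z) e = 0" "mul (R z) x = 0" "mul (R z) z = 0"
    using mc' nc0 by (auto simp add: Rz' mult_scale_left ze zx zz comb_scale mult.commute[of c'] comb_zero)
  have "basis3 (?E 0 0 1) (?E 0 2 0) (?E 1 0 0)" by (rule basis3_change[OF B]) simp
  hence B': "basis3 z (smul 2 x) e" by (simp add: comb_def)
  have "isomorphic_algebras smul (induced_mult mul R) (*s) (table_mult A_2_2)"
    by (rule ind.basis_table_isomorphic[OF B'])
      (simp_all add: A_2_2_def axis_def comb_def induced_mult_def R_scale Rx Re0 ee ex ez kill
        mult_scale_left mult_scale_right)
  thus ?thesis unfolding classified_def by blast
qed

text \<open>The crucial step is that \<open>R\<close> maps \<open>e\<close> and \<open>z\<close> to combinations without \<open>x\<close>. Otherwise \<open>w = x \<circ> x\<close>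
  would satisfy \<open>R w = \<omega> e - x / 2\<close>, and the Rota-Baxter identity for \<open>w, w\<close> would give \<open>\<omega> = 0\<close> and
  then \<open>w = 0\<close>, a contradiction. After that \<open>R\<close> maps \<open>e\<close> and \<open>z\<close> to the line of \<open>z\<close>, and either kills
  both or kills \<open>z\<close> with \<open>z \<circ> z = 0\<close>.\<close>

lemma classified_third_peirce_one_orthogonal:
  assumes B: "basis3 e x z" and ee: "mul e e = e" and ex: "mul e x = smul (1/2) x"
    and ez: "mul e z = z" and xz: "mul x z = 0" and Rx: "R x = e"
  shows ind_classified
proof -
  let ?E = "comb e x z"
  define h :: complex where "h = 1/2"
  have h: "h + h = 1" "h \<noteq> 0" by (simp_all add: h_def)
  have xe: "mul x e = smul (1/2) x" and ze: "mul z e = z" and zx: "mul z x = 0"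
    by (simp_all add: commute[of _ e] ex ez commute[of z x] xz)
  have lE: "mul e (?E a b c) = ?E a (b / 2) c" for a b c
    by (simp add: comb_def mult_add_right mult_scale_right ee ex ez)
  obtain s s' t where xx: "mul x x = ?E s s' t" using B by (rule basis3_coords)
  from peirce_half_product[OF ee ex ex] have "s' = 0"
    unfolding xx lE comb_eq_iff[OF B] by simp
  note xx = xx[unfolded this]
  obtain k m' m where zz: "mul z z = ?E k m' m" using B by (rule basis3_coords)
  have "mul e (mul z z) = smul 1 (mul z z)" by (rule peirce_product[OF ee, of z 1]) (simp_all add: ez)
  hence "m' = 0" unfolding zz lE comb_scale comb_eq_iff[OF B] by simp
  hence zz: "mul z z = ?E k 0 m" using zz by simp
  obtain a b c where Re: "R e = ?E a b c" using B by (rule basis3_coords)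
  obtain a' b' c' where Rz: "R z = ?E a' b' c'" using B by (rule basis3_coords)
  have mulE: "mul (?E p q r) (?E p' q' r')
      = ?E (p * p' + s * q * q' + k * r * r') (h * (p * q' + q * p'))
           (p * r' + r * p' + t * q * q' + m * r * r')"
    for p q r p' q' r'
    by (simp add: mul_comb ee ex ez xe ze xx zz xz zx h_def)
      (simp add: comb_def algebra_simps scale_left_distrib add_divide_distrib)
  have RE: "R (?E p q r) = ?E (p * a + q + r * a') (p * b + r * b') (p * c + r * c')" for p q r
    by (simp add: R_comb Re Rx Rz) (simp add: comb_def algebra_simps scale_left_distrib)
  note mulE1 = mulE[of 1 0 0, unfolded comb_unit] mulE[of _ _ _ 1 0 0, unfolded comb_unit]
    mulE[of 0 1 0, unfolded comb_unit] mulE[of _ _ _ 0 1 0, unfolded comb_unit]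
    mulE[of 0 0 1, unfolded comb_unit] mulE[of _ _ _ 0 0 1, unfolded comb_unit]
  have "mul (R x) (R e) = ?E a (h * b) c"
    by (simp add: Rx Re mulE1)
  moreover have "R (mul (R x) e) + R (mul x (R e)) = ?E (a + a * s * b + h * a + a' * t * b)
     (b + b * s * b + b' * t * b) (c + c * s * b + c' * t * b)"
    by (simp add: Rx Re ee mulE1 RE comb_simps) (simp add: comb_eq_iff[OF B] algebra_simps)
  ultimately have xe1: "a = a + a * s * b + h * a + a' * t * b"
    and xe2: "h * b = b + b * s * b + b' * t * b"
    and xe3: "c = c + c * s * b + c' * t * b" by (rule RB_coords[OF B])+
  have "mul (R x) (R z) = ?E a' (h * b') c'"
    by (simp add: Rx Rz mulE1)
  moreover have "R (mul (R x) z) + R (mul x (R z)) = ?E (a' + a * s * b' + h * a' + a' * t * b')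
     (b' + b * s * b' + b' * t * b') (c' + c * s * b' + c' * t * b')"
    by (simp add: Rx Rz ez mulE1 RE comb_simps) (simp add: comb_eq_iff[OF B] algebra_simps)
  ultimately have xz1: "a' = a' + a * s * b' + h * a' + a' * t * b'"
    and xz2: "h * b' = b' + b * s * b' + b' * t * b'"
    and xz3: "c' = c' + c * s * b' + c' * t * b'" by (rule RB_coords[OF B])+
  have bb: "b = 0 \<and> b' = 0"
  proof (rule ccontr)
    assume nz: "\<not> (b = 0 \<and> b' = 0)"
    have "b * h = b * (1 + (s * b + t * b'))" "b' * h = b' * (1 + (s * b + t * b'))"
      using xe2 xz2 by (simp_all add: algebra_simps)
    hence "h = 1 + (s * b + t * b')" using nz by auto
    hence "s * b + t * b' = h - 1" by (metis add_diff_cancel_left')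
    hence sig: "s * b + t * b' = - h" by (simp add: h_def)
    have "b * (s * c + t * c') = 0" "b' * (s * c + t * c') = 0"
      using xe3 xz3 by (simp_all add: algebra_simps)
    hence scp: "s * c + t * c' = 0" using nz by auto
    define om where "om = s * a + t * a'"
    have Rw: "R (?E s 0 t) = ?E om (- h) 0"
      using sig scp by (simp add: RE om_def)
    have "mul (R (?E s 0 t)) (R (?E s 0 t)) = ?E (om * om + s * h * h) (- h * om) (t * h * h)"
      unfolding Rw by (simp add: mulE) (simp add: comb_eq_iff[OF B] h_def)
    moreover have wm: "mul (?E s 0 t) (?E om (- h) 0) = ?E (s * om) (- h * h * s) (t * om)"
      by (simp add: mulE mult.commute mult.left_commute)
    hence "smul 2 (R (mul (?E s 0 t) (?E om (- h) 0)))
        = ?E (2 * om * om - 2 * h * h * s) (- 2 * h * om) 0"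
    proof -
      have "R (?E (s * om) (- h * h * s) (t * om))
          = ?E (om * (s * a + t * a') - h * h * s) (om * (s * b + t * b')) (om * (s * c + t * c'))"
        by (simp add: RE comb_eq_iff[OF B] algebra_simps)
      thus ?thesis using wm
        unfolding sig scp om_def[symmetric] by (simp add: comb_scale right_diff_distrib mult_ac)
    qed
    ultimately have w: "om * om + s * h * h = 2 * om * om - 2 * h * h * s"
      "- h * om = - 2 * h * om" "t * h * h = 0"
      using RB_square[of "?E s 0 t"] unfolding Rw by (simp_all only: comb_eq_iff[OF B])
    have "om = 0" using w(2) h by simp
    hence "3 * (h * h * s) = 0" using w(1) by (simp add: algebra_simps)
    hence "s = 0" using h by simp
    moreover have "t = 0" using w(3) h by simp
    ultimately show False using sig h by simp
  qed
  have "h * a = 0" "h * a' = 0" using xe1 xz1 bb by simp_all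
  hence aa: "a = 0" "a' = 0" using h by simp_all
  have Re: "R e = smul c z" and Rz: "R z = smul c' z"
    using Re Rz bb aa by (simp_all add: comb_def)
  have "mul (R e) (R e) = ?E (c * c * k) 0 (c * c * m)"
    by (simp add: Re mult_scale_left mult_scale_right zz comb_scale algebra_simps)
  moreover have "R (mul (R e) e) + R (mul e (R e)) = ?E 0 0 (2 * c * c')"
    by (simp add: Re mult_scale_left mult_scale_right ze ez R_scale Rz comb_def
        algebra_simps flip: scale_left_distrib)
  ultimately have ee1: "c * c * k = 0" and ee3: "c * c * m = 2 * c * c'"
    by (rule RB_coords[OF B])+
  have "mul (R e) (R z) = ?E (c * c' * k) 0 (c * c' * m)"
    by (simp add: Re Rz mult_scale_left mult_scale_right zz comb_scale algebra_simps)
  moreover have "R (mul (R e) z) + R (mul e (R z)) = ?E 0 0 (c * (k * c + m * c') + c' * c')"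
    by (simp add: Re Rz mult_scale_left mult_scale_right zz ez R_scale RE bb aa)
      (simp add: comb_def Rz algebra_simps flip: scale_left_distrib)
  ultimately have ez3: "c * c' * m = c * (k * c + m * c') + c' * c'"
    by (rule RB_coords[OF B])+
  have c': "c' = 0 \<and> (c = 0 \<or> k = 0 \<and> m = 0)"
  proof (cases "c = 0")
    case True
    thus ?thesis using ez3 by simp
  next
    case False
    hence k: "k = 0" using ee1 by simp
    hence c': "c' = 0" using ez3 by (simp add: algebra_simps)
    thus ?thesis using ee3 False k by simp
  qed
  show ?thesis
  proof (cases "c = 0")
    case True
    hence R0: "R e = 0" "R z = 0" using Re Rz c' by simp_all
    have "basis3 (?E 0 2 0) (?E 1 0 0) (?E 0 0 1)" by (rule basis3_change[OF B]) simp
    hence B': "basis3 (smul 2 x) e z" by (simp add: comb_def)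
    have "isomorphic_algebras smul (induced_mult mul R) (*s) (table_mult A_1_4_3)"
      by (rule ind.basis_table_isomorphic[OF B'])
        (simp_all add: A_1_4_3_def axis_def comb_def induced_mult_def R_scale Rx R0 ee ex ez
          mult_scale_left mult_scale_right)
    thus ?thesis unfolding classified_def by blast
  next
    case False
    hence zz: "mul z z = 0" and Rz: "R z = 0" using zz Rz c' by (simp_all add: comb_zero)
    have "basis3 (?E 0 2 0) (?E 1 0 0) (?E 0 0 c)" by (rule basis3_change[OF B]) (simp add: False)
    hence B': "basis3 (smul 2 x) e (smul c z)" by (simp add: comb_def)
    have "isomorphic_algebras smul (induced_mult mul R) (*s) (table_mult A_1_3_2)"
      by (rule ind.basis_table_isomorphic[OF B'])
        (simp_all add: A_1_3_2_def axis_def comb_def induced_mult_def R_scale Rx Re Rz ee ex ez ze zz zx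
          mult_scale_left mult_scale_right)
    thus ?thesis unfolding classified_def by blast
  qed
qed

text \<open>Since \<open>z \<circ> x\<close> is a multiple \<open>n x\<close> and \<open>e \<circ> x = x / 2\<close>, replacing \<open>z\<close> by \<open>z - 2 n e\<close> makes it
  orthogonal to \<open>x\<close>.\<close>

lemma classified_third_peirce_one:
  assumes B: "basis3 e x z" and ee: "mul e e = e" and ex: "mul e x = smul (1/2) x"
    and ez: "mul e z = z" and Rx: "R x = e"
  shows ind_classified
proof -
  obtain n1 n n2 where zx: "mul z x = comb e x z n1 n n2" using B by (rule basis3_coords)
  have "mul e (mul z x) = smul (1/2) (mul z x)"
    by (rule peirce_product[OF ee _ ex, of z 1]) (simp_all add: ez)
  moreover have "mul e (mul z x) = comb e x z n1 (n / 2) n2"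
    by (simp add: zx comb_def mult_add_right mult_scale_right ee ex ez)
  ultimately have "comb e x z n1 (n / 2) n2 = smul (1/2) (mul z x)" by simp
  hence "n1 = 0 \<and> n2 = 0" unfolding zx comb_scale comb_eq_iff[OF B] by simp
  hence zx: "mul z x = smul n x" using zx by (simp add: comb_def)
  let ?z = "comb e x z (- 2 * n) 0 1"
  have "basis3 (comb e x z 1 0 0) (comb e x z 0 1 0) ?z" by (rule basis3_change[OF B]) simp
  hence "basis3 e x ?z" by (simp only: comb_unit)
  moreover have "mul e ?z = ?z"
    by (simp add: comb_def mul_diff_right mult_add_right mult_scale_right ee ez)
  moreover have "mul x ?z = 0"
    by (simp add: comb_def mul_diff_right mult_add_right mult_scale_right ex zx
        commute[of x e] commute[of x z])
  ultimately show ?thesis using ee ex Rx by (intro classified_third_peirce_one_orthogonal)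
qed

text \<open>Multiplication by \<open>e\<close> preserves the kernel of \<open>R\<close>, and \<open>2 (e \<circ> y) - y\<close> lies in it. In Peirce components
  this vector is \<open>y\<^sub>1 - y\<^sub>0\<close>, so \<open>y\<^sub>1\<close> and \<open>y\<^sub>0\<close> are both in the kernel and the component \<open>x\<close> in
  \<open>J\<^sub>1\<^sub>/\<^sub>2(e)\<close> maps to \<open>e\<close>. Some Peirce component of any vector outside the plane of \<open>e\<close> and \<open>x\<close>
  is also outside it and completes the basis.\<close>

theorem classified_if_idempotent_in_range:
  assumes e0: "e \<noteq> 0" and ee: "mul e e = e" and Ry: "R y = e"
  shows ind_classified
proof -
  have ker: "R (mul e k) = 0" if "R k = 0" for k
    using RB[of y k] that Ry by simp
  obtain y1 x y0 where y: "y = y1 + x + y0"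
    and ey: "mul e y1 = y1" "mul e x = smul (1/2) x" "mul e y0 = 0"
    using peirce_decomposition[OF ee] by blast
  have "smul 2 (mul e y) - y = y1 - y0"
    using scale_left_distrib[of 1 1 y1] by (simp add: y mult_add_right ey scale_right_distrib)
  moreover have "R (smul 2 (mul e y)) = e"
    using RB_square[of y] by (simp add: R_scale Ry ee commute[of y e])
  ultimately have k0: "R (y1 - y0) = 0" by (metis R_diff Ry diff_self)
  from ker[OF this] have "R y1 = 0" by (simp add: mul_diff_right ey)
  moreover from this k0 have "R y0 = 0" by (simp add: R_diff)
  ultimately have Rx: "R x = e" using Ry by (simp add: y R_add)
  have x: "x \<notin> span {e}"
  proof
    assume "x \<in> span {e}"
    then obtain c where c: "x = smul c e" by (auto simp: span_singleton)
    hence "smul c e = smul (c / 2) e" using ey(2) by (simp add: mult_scale_right ee)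
    hence "c = 0" using e0 by (simp add: scale_cancel_right)
    thus False using c Rx e0 by simp
  qed
  obtain w where w: "basis3 e x w" using basis3_extend2[OF dim3 e0 x] .
  obtain z1 zh z0 where dec: "w = z1 + zh + z0"
    and ez: "mul e z1 = z1" "mul e zh = smul (1/2) zh" "mul e z0 = 0"
    using peirce_decomposition[OF ee] by blast
  have "w \<notin> span {e, x}"
  proof
    assume "w \<in> span {e, x}"
    then obtain a b where "w = smul a e + smul b x" by (auto simp: span_pair_iff)
    hence "comb e x w 0 0 1 = comb e x w a b 0" by (simp add: comb_def)
    thus False by (simp add: comb_eq_iff[OF w])
  qed
  hence "z1 \<notin> span {e, x} \<or> zh \<notin> span {e, x} \<or> z0 \<notin> span {e, x}"
    unfolding dec by (metis span_add)
  thus ?thesis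
    using classified_third_peirce_one[OF _ ee ey(2) ez(1) Rx] classified_third_peirce_half[OF _ ee ey(2) ez(2) Rx]
      classified_third_peirce_zero[OF _ ee ey(2) ez(3) Rx] basis3_of_not_in_span[OF dim3 e0 x] by blast
qed

section \<open>A nilpotent range\<close>

lemma classified_zero_product:
  assumes "\<And>x y. mul (R x) y = 0"
  shows ind_classified
proof -
  have "\<exists>u::'a. u \<noteq> 0"
  proof (rule ccontr)
    assume "\<not> (\<exists>u::'a. u \<noteq> 0)"
    hence "UNIV \<subseteq> span {}" by auto
    thus False using dim_le_card[of UNIV "{}"] dim3 by simp
  qed
  then obtain u v w where B: "basis3 u v w" using basis3_extend1[OF dim3] by blast
  show ?thesis
    by (rule ind.classified_bilinear_form[OF B, of 0 0 0 0]) (simp_all add: induced_mult_def assms)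
qed

text \<open>The algebra consists of the polynomials without constant term modulo the fourth power of the variable. The
  Rota-Baxter equations make \<open>R\<close> triangular. If its first eigenvalue \<open>x1\<close> is nonzero, the second is \<open>x1/2\<close>,
  which gives the asymmetry of \<open>A_4_1 (1/3)\<close>; otherwise all products are multiples of \<open>w\<close>.\<close>

lemma classified_power_basis:
  assumes B: "basis3 u v w" and uu: "mul u u = v" and uv: "mul u v = w" and uw: "mul u w = 0"
    and vv: "mul v v = 0" and vw: "mul v w = 0" and ww: "mul w w = 0"
  shows ind_classified
proof -
  let ?E = "comb u v w"
  obtain x1 x2 x3 where Ru: "R u = ?E x1 x2 x3" using B by (rule basis3_coords)
  obtain p1 p2 p3 where Rv: "R v = ?E p1 p2 p3" using B by (rule basis3_coords)
  obtain q1 q2 q3 where Rw: "R w = ?E q1 q2 q3" using B by (rule basis3_coords)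
  have mulE: "mul (?E a b c) (?E a' b' c') = ?E 0 (a * a') (a * b' + b * a')" for a b c a' b' c'
    by (simp add: mul_comb uu uv uw vv vw ww commute[of v u] commute[of w u] commute[of w v])
      (simp add: comb_def scale_left_distrib)
  have RE: "R (?E a b c) = ?E (a * x1 + b * p1 + c * q1) (a * x2 + b * p2 + c * q2)
      (a * x3 + b * p3 + c * q3)" for a b c
    by (simp add: R_comb Ru Rv Rw comb_simps)
  note mulE1 = mulE[of 1 0 0, unfolded comb_unit] mulE[of _ _ _ 1 0 0, unfolded comb_unit]
    mulE[of 0 1 0, unfolded comb_unit] mulE[of _ _ _ 0 1 0, unfolded comb_unit]
    mulE[of 0 0 1, unfolded comb_unit] mulE[of _ _ _ 0 0 1, unfolded comb_unit]
  have "mul (R w) (R w) = ?E 0 (q1 * q1) (2 * q1 * q2)" by (simp add: Rw mulE mult.assoc)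
  moreover have "R (mul (R w) w) + R (mul w (R w)) = ?E 0 0 0"
    by (simp add: Rw mulE1 comb_zero)
  ultimately have "q1 * q1 = 0" by (rule RB_coords[OF B])
  hence q1: "q1 = 0" by simp
  have "mul (R v) (R v) = ?E 0 (p1 * p1) (2 * p1 * p2)" by (simp add: Rv mulE mult.assoc)
  moreover have "R (mul (R v) v) + R (mul v (R v)) = ?E 0 (2 * p1 * q2) (2 * p1 * q3)"
    by (simp add: Rv mulE1 RE comb_simps q1 mult_ac)
  ultimately have p11: "p1 * p1 = 2 * p1 * q2" by (rule RB_coords[OF B])
  have "mul (R v) (R w) = ?E 0 0 (p1 * q2)" by (simp add: Rv Rw mulE q1)
  moreover have "R (mul (R v) w) + R (mul v (R w)) = ?E 0 0 0"
    by (simp add: Rv Rw mulE1 q1 comb_zero)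
  ultimately have "p1 * q2 = 0" by (rule RB_coords[OF B])
  hence p1: "p1 = 0" using p11 by auto
  have "mul (R u) (R w) = ?E 0 0 (x1 * q2)" by (simp add: Ru Rw mulE q1)
  moreover have "R (mul (R u) w) + R (mul u (R w)) = ?E 0 (q2 * q2) (q2 * q3)"
    by (simp add: Ru Rw mulE1 RE q1 comb_zero)
  ultimately have "0 = q2 * q2" by (rule RB_coords[OF B])
  hence q2: "q2 = 0" by simp
  have "mul (R u) (R u) = ?E 0 (x1 * x1) (2 * x1 * x2)" by (simp add: Ru mulE mult.assoc)
  moreover have "R (mul (R u) u) + R (mul u (R u)) = ?E 0 (2 * x1 * p2) (2 * (x1 * p3 + x2 * q3))"
    by (simp add: Ru mulE1 RE p1 q1 q2 comb_simps mult_ac)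
  ultimately have uu2: "x1 * x1 = 2 * x1 * p2"
    by (rule RB_coords[OF B])
  have prod: "mul (R (?E a b c)) (?E a' b' c') = ?E 0 (a * x1 * a')
      (a * x1 * b' + (a * x2 + b * p2) * a')" for a b c a' b' c'
    by (simp add: RE mulE p1 q1 q2)
  note prod1 = prod[of 1 0 0, unfolded comb_unit] prod[of _ _ _ 1 0 0, unfolded comb_unit]
    prod[of 0 1 0, unfolded comb_unit] prod[of _ _ _ 0 1 0, unfolded comb_unit]
    prod[of 0 0 1, unfolded comb_unit] prod[of _ _ _ 0 0 1, unfolded comb_unit]
  note prod2 = prod1[of 1 0 0, unfolded comb_unit] prod1[of 0 1 0, unfolded comb_unit]
    prod1[of 0 0 1, unfolded comb_unit]
  show ?thesis
  proof (cases "x1 = 0")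
    case True
    have wt: "mul w t = 0" for t
    proof -
      obtain a b c where "t = ?E a b c" using B by (rule basis3_coords)
      thus ?thesis by (simp add: mulE1 comb_zero)
    qed
    have Rw': "R w = smul q3 w" by (simp add: Rw q1 q2 comb_def)
    show ?thesis
    proof (rule ind.classified_bilinear_form[OF B, of x2 0 p2 0], unfold induced_mult_def)
      show "mul (R w) t = 0" "mul (R t) w = 0" for t
        by (simp_all add: Rw' mult_scale_left wt commute[of _ w])
      show "mul (R u) u = smul x2 w" "mul (R u) v = smul 0 w" "mul (R v) u = smul p2 w"
        "mul (R v) v = smul 0 w"
        by (simp_all add: Ru Rv mulE1 True p1) (simp_all add: comb_def)
    qed simp
  next
    case False
    hence p2: "p2 = x1 / 2" using uu2 by (simp add: field_simps)
    \<comment> \<open>The factor solves \<open>(1 + 1/3) kap = x1\<^sup>2\<close> and \<open>(1 - 1/3) kap = x1\<^sup>2 / 2\<close> simultaneously.\<close>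
    define kap where "kap = 3 / 4 * (x1 * x1)"
    have sq: "x1 * x1 = 4 / 3 * kap" and kap: "kap \<noteq> 0" using False by (simp_all add: kap_def)
    let ?v = "?E 0 x1 x2" and ?w = "?E 0 0 kap"
    have "basis3 (?E 1 0 0) ?v ?w" by (rule basis3_change[OF B]) (simp add: False kap)
    hence B': "basis3 u ?v ?w" by (simp only: comb_unit)
    have outer: "comb u ?v ?w a b c = ?E a (b * x1) (b * x2 + c * kap)" for a b c
      unfolding comb_def[of u ?v ?w] by (simp add: comb_scale comb_add) (simp add: comb_def scale_left_distrib)
    have "isomorphic_algebras smul (induced_mult mul R) (*s) (table_mult (A_4_1 (1/3)))"
      by (rule ind.basis_table_isomorphic[OF B'])
        (simp_all add: A_4_1_def axis_def induced_mult_def outer prod prod1 prod2 p2 sq)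
    thus ?thesis unfolding classified_def by blast
  qed
qed

text \<open>With Gram matrix \<open>Q\<close> of the Jordan product and matrix \<open>A\<close> of \<open>R\<close> modulo \<open>w\<close>, the induced form is
  \<open>A Q\<close>, and the \<open>w\<close>-coordinates of the Rota-Baxter identity say \<open>A Q A\<^sup>T = c (A Q + Q A\<^sup>T)\<close>. If the
  symmetric part of \<open>A Q\<close> is degenerate, then \<open>det A\<^sup>2 det Q = 0\<close>, so \<open>A Q\<close> has rank at most one, and a form of
  rank at most one with degenerate symmetric part is symmetric.\<close>

lemma classified_if_square_one_dimensional:
  assumes B: "basis3 u v w" and ann: "\<And>t. mul w t = 0"
    and uu: "mul u u = smul k11 w" and uv: "mul u v = smul k12 w" and vv: "mul v v = smul k22 w"
  shows ind_classified
proof -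
  let ?E = "comb u v w"
  obtain r11 r12 r13 where Ru: "R u = ?E r11 r12 r13" using B by (rule basis3_coords)
  obtain r21 r22 r23 where Rv: "R v = ?E r21 r22 r23" using B by (rule basis3_coords)
  obtain a b c where Rw: "R w = ?E a b c" using B by (rule basis3_coords)
  have tw: "mul t w = 0" for t using ann[of t] by (simp add: commute)
  have mulE: "mul (?E p q r) (?E p' q' r') = ?E 0 0 (p * p' * k11 + (p * q' + q * p') * k12 + q * q' * k22)"
    for p q r p' q' r'
    by (simp add: mul_comb uu uv vv commute[of v u] ann tw) (simp add: comb_def algebra_simps scale_left_distrib)
  have RE: "R (?E p q r) = ?E (p * r11 + q * r21 + r * a) (p * r12 + q * r22 + r * b)
      (p * r13 + q * r23 + r * c)" for p q r
    by (simp add: R_comb Ru Rv Rw comb_simps)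
  note mulE1 = mulE[of 1 0 0, unfolded comb_unit] mulE[of _ _ _ 1 0 0, unfolded comb_unit]
    mulE[of 0 1 0, unfolded comb_unit] mulE[of _ _ _ 0 1 0, unfolded comb_unit]
  \<comment> \<open>If \<open>u \<circ> R w\<close> were nonzero, the pair \<open>u, w\<close> would force \<open>R w\<close> into the line of \<open>w\<close>, which annihilates
    everything. Hence \<open>R w\<close> annihilates \<open>u\<close>, and likewise \<open>v\<close>.\<close>
  have g1: "a * k11 + b * k12 = 0"
  proof (rule ccontr)
    assume nz: "a * k11 + b * k12 \<noteq> 0" (is "?g \<noteq> 0")
    have "mul (R u) (R w) = ?E 0 0 ((r11 * a) * k11 + (r11 * b + r12 * a) * k12 + r12 * b * k22)"
      by (simp add: Ru Rw mulE)
    moreover have "R (mul (R u) w) + R (mul u (R w)) = ?E (?g * a) (?g * b) (?g * c)"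
      by (simp add: Ru Rw tw mulE1 RE)
    ultimately have "0 = ?g * a" "0 = ?g * b" by (rule RB_coords[OF B])+
    thus False using nz by auto
  qed
  have g2: "a * k12 + b * k22 = 0"
  proof (rule ccontr)
    assume nz: "a * k12 + b * k22 \<noteq> 0" (is "?g \<noteq> 0")
    have "mul (R v) (R w) = ?E 0 0 ((r21 * a) * k11 + (r21 * b + r22 * a) * k12 + r22 * b * k22)"
      by (simp add: Rv Rw mulE)
    moreover have "R (mul (R v) w) + R (mul v (R w)) = ?E (?g * a) (?g * b) (?g * c)"
      by (simp add: Rv Rw tw mulE1 RE)
    ultimately have "0 = ?g * a" "0 = ?g * b" by (rule RB_coords[OF B])+
    thus False using nz by auto
  qed
  define p where "p = r11 * k11 + r12 * k12"
  define q where "q = r11 * k12 + r12 * k22"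
  define r where "r = r21 * k11 + r22 * k12"
  define s where "s = r21 * k12 + r22 * k22"
  have "mul (R u) (R u) = ?E 0 0 (r11 * r11 * k11 + (r11 * r12 + r12 * r11) * k12 + r12 * r12 * k22)"
    by (simp add: Ru mulE)
  moreover have "R (mul (R u) u) + R (mul u (R u)) = ?E (2 * p * a) (2 * p * b) (2 * p * c)"
    by (simp add: Ru mulE1 RE comb_simps) (simp add: comb_eq_iff[OF B] p_def)
  ultimately have e11: "r11 * r11 * k11 + (r11 * r12 + r12 * r11) * k12 + r12 * r12 * k22 = 2 * p * c"
    by (rule RB_coords[OF B])
  have "mul (R u) (R v) = ?E 0 0 (r11 * r21 * k11 + (r11 * r22 + r12 * r21) * k12 + r12 * r22 * k22)"
    by (simp add: Ru Rv mulE)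
  moreover have "R (mul (R u) v) + R (mul u (R v)) = ?E ((q + r) * a) ((q + r) * b) ((q + r) * c)"
    by (simp add: Ru Rv mulE1 RE comb_simps) (simp add: comb_eq_iff[OF B] q_def r_def algebra_simps)
  ultimately have e12: "r11 * r21 * k11 + (r11 * r22 + r12 * r21) * k12 + r12 * r22 * k22 = (q + r) * c"
    by (rule RB_coords[OF B])
  have "mul (R v) (R v) = ?E 0 0 (r21 * r21 * k11 + (r21 * r22 + r22 * r21) * k12 + r22 * r22 * k22)"
    by (simp add: Rv mulE)
  moreover have "R (mul (R v) v) + R (mul v (R v)) = ?E (2 * s * a) (2 * s * b) (2 * s * c)"
    by (simp add: Rv mulE1 RE comb_simps) (simp add: comb_eq_iff[OF B] s_def)
  ultimately have e22: "r21 * r21 * k11 + (r21 * r22 + r22 * r21) * k12 + r22 * r22 * k22 = 2 * s * c"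
    by (rule RB_coords[OF B])
  show ?thesis
  proof (rule ind.classified_bilinear_form[OF B, of p q r s], unfold induced_mult_def)
    show "mul (R w) t = 0" for t
    proof -
      obtain x y z where t: "t = ?E x y z" using B by (rule basis3_coords)
      have "mul (R w) t = ?E 0 0 (x * (a * k11 + b * k12) + y * (a * k12 + b * k22))"
        by (simp add: t Rw mulE) (simp add: comb_eq_iff[OF B] algebra_simps)
      thus ?thesis by (simp add: g1 g2 comb_zero)
    qed
    show "mul (R t) w = 0" for t by (rule tw)
    show "mul (R u) u = smul p w" "mul (R u) v = smul q w" "mul (R v) u = smul r w"
      "mul (R v) v = smul s w"
      by (simp_all add: Ru Rv mulE1 p_def q_def r_def s_def) (simp_all add: comb_def algebra_simps)
    show "q = r" if deg: "4 * p * s = (q + r)\<^sup>2"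
    proof -
      define D where "D = (r11 * r22 - r12 * r21) * (k11 * k22 - k12 * k12)"
      have "D * (r11 * r22 - r12 * r21)
        = (r11 * r11 * k11 + (r11 * r12 + r12 * r11) * k12 + r12 * r12 * k22)
          * (r21 * r21 * k11 + (r21 * r22 + r22 * r21) * k12 + r22 * r22 * k22)
        - (r11 * r21 * k11 + (r11 * r22 + r12 * r21) * k12 + r12 * r22 * k22)
          * (r11 * r21 * k11 + (r11 * r22 + r12 * r21) * k12 + r12 * r22 * k22)"
        unfolding D_def by (simp add: algebra_simps)
      also have "\<dots> = c * c * (4 * p * s - (q + r)\<^sup>2)"
        unfolding e11 e12 e22 by (simp add: power2_eq_square algebra_simps)
      also have "\<dots> = 0" using deg by simp
      finally have "D = 0" by (auto simp: D_def)
      moreover have "p * s - q * r = D"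
        unfolding D_def p_def q_def r_def s_def by (simp add: algebra_simps)
      ultimately have "p * s = q * r" by simp
      hence "(q + r)\<^sup>2 = 4 * (q * r)" using deg by (simp add: mult.assoc)
      hence "(q - r) * (q - r) = 0" by (simp add: power2_eq_square algebra_simps)
      thus ?thesis by simp
    qed
  qed
qed

text \<open>Complete \<open>b\<close> and \<open>c = b \<circ> b\<close> to a basis by \<open>d\<close>. Linearised, the vanishing of all cubes leaves only
  \<open>b \<circ> d\<close> and \<open>d \<circ> d\<close> as further products, both multiples of \<open>c\<close>, and makes \<open>c\<close> annihilate the algebra.\<close>

lemma classified_if_cubes_vanish:
  assumes cube: "\<And>a. mul a (mul a a) = 0" and bb: "mul b b \<noteq> 0"
  shows ind_classified
proof -
  define c where "c = mul b b"
  have bc: "mul b c = 0" by (simp add: c_def cube)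
  hence cc: "mul c c = 0" using jordan_fourth_power[of b] by (simp add: c_def)
  have b0: "b \<noteq> 0" using bb by auto
  have "c \<notin> span {b}"
  proof
    assume "c \<in> span {b}"
    then obtain k where k: "c = smul k b" by (auto simp: span_singleton)
    hence "smul k c = 0" using bc by (simp add: mult_scale_right c_def)
    thus False using k bb b0 by (auto simp: c_def)
  qed
  then obtain d where B: "basis3 b c d" using basis3_extend2[OF dim3 b0] by blast
  let ?E = "comb b c d"
  obtain p q r where bd: "mul b d = ?E p q r" using B by (rule basis3_coords)
  obtain l1 l2 l3 where cd: "mul c d = ?E l1 l2 l3" using B by (rule basis3_coords)
  obtain i j k where dd: "mul d d = ?E i j k" using B by (rule basis3_coords)
  have cb: "mul c b = 0" and db: "mul d b = ?E p q r" and dc: "mul d c = ?E l1 l2 l3"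
    by (simp_all add: commute[of c b] commute[of d] bc bd cd)
  have bE: "mul b (?E x y z) = ?E (z * p) (x + z * q) (z * r)" for x y z
    by (simp add: comb_def mult_add_right mult_scale_right bd bc flip: c_def)
      (simp add: comb_def scale_left_distrib scale_right_distrib)
  have cE: "mul c (?E x y z) = ?E (z * l1) (z * l2) (z * l3)" for x y z
    by (simp add: comb_def mult_add_right mult_scale_right cd cb cc)
      (simp add: comb_def scale_left_distrib scale_right_distrib)
  have dE: "mul d (?E x y z) = ?E (x * p + y * l1 + z * i) (x * q + y * l2 + z * j) (x * r + y * l3 + z * k)"
    for x y z
    by (simp add: comb_def mult_add_right mult_scale_right db dc dd)
      (simp add: comb_def scale_left_distrib scale_right_distrib)
  have lin: "?E a1 a2 a3 = 0 \<longleftrightarrow> a1 = 0 \<and> a2 = 0 \<and> a3 = 0" for a1 a2 a3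
    by (rule comb_eq_0_iff[OF B])
  have "mul d c + smul 2 (mul b (mul b d)) = 0"
    using cube_zero_linearized[OF cube, of d b] by (simp add: c_def)
  hence l: "l1 + 2 * (r * p) = 0" "l2 + 2 * (p + r * q) = 0" "l3 + 2 * (r * r) = 0"
    unfolding dc bd bE comb_simps lin by simp_all
  have "mul d (mul c c) + smul 2 (mul c (mul c d)) = 0" by (rule cube_zero_linearized[OF cube])
  hence "l3 = 0" unfolding cc cd cE comb_simps by (simp add: lin)
  hence r: "r = 0" using l by simp
  hence l: "l1 = 0" "l2 = - 2 * p" "l3 = 0" using l by (simp_all add: add_eq_0_iff2)
  have "mul d (mul d d) = 0" by (rule cube)
  hence "k * k = 0" unfolding dd dE lin by (simp add: r l)
  hence k: "k = 0" by simp
  have "mul c (mul d d) + smul 2 (mul d (mul d c)) = 0" by (rule cube_zero_linearized[OF cube])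
  hence "p = 0" unfolding dd dc cE dE comb_simps lin by (simp add: l k)
  hence p: "p = 0" "l2 = 0" using l by simp_all
  have "mul b (mul d d) + smul 2 (mul d (mul d b)) = 0" by (rule cube_zero_linearized[OF cube])
  hence i: "i = 0" unfolding dd db bE dE comb_simps lin by (simp add: l k p r)
  have "basis3 (?E 1 0 0) (?E 0 0 1) (?E 0 1 0)" by (rule basis3_change[OF B]) simp
  hence B': "basis3 b d c" by (simp add: comb_unit)
  show ?thesis
  proof (rule classified_if_square_one_dimensional[OF B', of 1 q j])
    show "mul c t = 0" for t
    proof -
      obtain x y z where "t = ?E x y z" using B by (rule basis3_coords)
      thus ?thesis by (simp add: cE l p comb_zero)
    qed
    show "mul b b = smul 1 c" "mul b d = smul q c" "mul d d = smul j c"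
      by (simp_all add: c_def bd dd p r i k comb_def)
  qed
qed

text \<open>Rank and nullity for a map of rank two, together with the fact that a vector of the range outside the plane
  of \<open>v\<close> and \<open>v'\<close> would make \<open>R\<close> surjective.\<close>

lemma kernel_of_rank_two:
  assumes B: "basis3 v v' y" and v: "v \<in> range R" and v': "v' \<in> range R" and ns: "\<not> surj R"
  obtains k where "k \<noteq> 0" "R k = 0" "\<And>x. R x = 0 \<Longrightarrow> \<exists>c. x = smul c k"
    "\<And>x. \<exists>p q. R x = comb v v' y p q 0"
proof -
  let ?E = "comb v v' y"
  obtain a a' where a: "v = R a" and a': "v' = R a'" using v v' by blast
  have img: "\<exists>p q. R x = ?E p q 0" for x
  proof -
    obtain p q r where x: "R x = ?E p q r" using B by (rule basis3_coords)
    have "r = 0"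
    proof (rule ccontr)
      assume r: "r \<noteq> 0"
      have "\<exists>s. z = R s" for z
      proof -
        obtain z1 z2 z3 where z: "z = ?E z1 z2 z3" using B by (rule basis3_coords)
        have "R (comb a a' x (z1 - z3 / r * p) (z2 - z3 / r * q) (z3 / r))
            = smul (z1 - z3 / r * p) (?E 1 0 0) + smul (z2 - z3 / r * q) (?E 0 1 0)
              + smul (z3 / r) (?E p q r)"
          by (simp only: R_comb x a a' comb_unit)
        also have "\<dots> = z" using r by (simp add: comb_simps z)
        finally show ?thesis by metis
      qed
      thus False using ns unfolding surj_def by blast
    qed
    thus ?thesis using x by blast
  qed
  have ind: "p = 0 \<and> q = 0" if "smul p v + smul q v' = 0" for p q
    using comb_eq_0_iff[OF B, of p q 0] that by (simp add: comb_def)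
  have a0: "a \<noteq> 0" using ind[of 1 0] a by auto
  have "a' \<notin> span {a}"
  proof
    assume "a' \<in> span {a}"
    then obtain t where "a' = smul t a" by (auto simp: span_singleton)
    thus False using ind[of "- t" 1] by (simp add: a a' R_scale)
  qed
  then obtain d where D: "basis3 a a' d" using basis3_extend2[OF dim3 a0] by blast
  obtain p q where Rd: "R d = ?E p q 0" using img by blast
  define k where "k = comb a a' d (- p) (- q) 1"
  have Rk: "R k = 0" by (simp add: k_def R_comb Rd flip: a a') (simp add: comb_def)
  have "k \<noteq> 0" by (simp add: k_def comb_eq_0_iff[OF D])
  moreover have "\<exists>c. x = smul c k" if Rx: "R x = 0" for x
  proof -
    obtain x1 x2 x3 where x: "x = comb a a' d x1 x2 x3" using D by (rule basis3_coords)
    have "smul (x1 + x3 * p) v + smul (x2 + x3 * q) v' = R x"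
      by (simp add: x R_comb Rd flip: a a') (simp add: comb_def scale_right_distrib scale_left_distrib algebra_simps)
    hence "x1 + x3 * p = 0 \<and> x2 + x3 * q = 0" using Rx ind by metis
    hence "x = smul x3 k" by (simp add: x k_def comb_scale add_eq_0_iff2)
    thus ?thesis ..
  qed
  ultimately show ?thesis using that Rk img by blast
qed

lemma range_kernel: "R k = 0 \<Longrightarrow> R (mul (R x) k) = 0"
  using RB[of x k] by simp

text \<open>Rota-Baxter identities give \<open>y \<circ> c = s c\<close> and \<open>y \<circ> b = i b + t c\<close> with \<open>2 i q = 1\<close>. The Jordan
  identity for powers of \<open>y\<close>, applied to \<open>b\<close> and \<open>c\<close>, relates the eigenvalues \<open>i\<close> and \<open>s\<close> to the coefficient
  \<open>al\<close> of \<open>y\<close> in \<open>y \<circ> y\<close> and leaves only \<open>s = 0\<close>, \<open>s = i\<close> and \<open>s = 2 i\<close>. These are the three algebras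
  \<open>A_4_1\<close>.\<close>

lemma classified_square_chain:
  assumes B: "basis3 b c y" and bb: "mul b b = c" and bc: "mul b c = 0" and cc: "mul c c = 0"
    and Ry: "R y = b" and Rb: "R b = smul q c" and q: "q \<noteq> 0" and Rc: "R c = 0"
  shows ind_classified
proof -
  let ?E = "comb b c y"
  have RE: "R (?E x1 x2 x3) = ?E x3 (x1 * q) 0" for x1 x2 x3
    by (simp add: R_comb Ry Rb Rc) (simp add: comb_def)
  have cb: "mul c b = 0" by (simp add: commute[of c b] bc)
  obtain s1 s s3 where yc: "mul y c = ?E s1 s s3" using B by (rule basis3_coords)
  have "mul (R y) (R b) = 0" by (simp add: Ry Rb mult_scale_right bc)
  hence "R (mul (R y) b) + R (mul y (R b)) = 0" using RB[of y b] by simp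
  hence "smul q (R (mul y c)) = 0" by (simp add: Ry Rb bb Rc mult_scale_right R_scale)
  hence "s1 = 0 \<and> s3 = 0" using q by (simp add: yc RE comb_eq_0_iff[OF B])
  hence yc: "mul y c = smul s c" using yc by (simp add: comb_def)
  obtain i t k where yb: "mul y b = ?E i t k" using B by (rule basis3_coords)
  have "smul 2 (R (mul y b)) = c" using RB_square[of y] by (simp add: Ry bb)
  hence "?E (2 * k) (2 * (i * q)) 0 = ?E 0 1 0" by (simp add: yb RE comb_scale comb_unit)
  hence k: "k = 0" and iq: "2 * (i * q) = 1" by (simp_all only: comb_eq_iff[OF B]) simp
  have i0: "i \<noteq> 0" using iq by auto
  have qi: "q = 1 / (2 * i)" using iq i0 by (simp add: field_simps)
  have yb: "mul y b = ?E i t 0" using yb k by simp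
  have by_: "mul b y = ?E i t 0" and cy: "mul c y = smul s c"
    by (simp_all add: commute[of _ y] yb yc)
  obtain f g al where yy: "mul y y = ?E f g al"
    using B by (metis basis3_coords)
  have mulE: "mul (?E x1 x2 x3) (?E z1 z2 z3) = ?E (i * (x1 * z3 + x3 * z1) + x3 * z3 * f)
      (x1 * z1 + t * (x1 * z3 + x3 * z1) + s * (x2 * z3 + x3 * z2) + x3 * z3 * g) (x3 * z3 * al)"
    for x1 x2 x3 z1 z2 z3
    by (simp add: mul_comb bb bc cc cb by_ yb cy yc yy)
      (simp add: comb_def scale_left_distrib scale_right_distrib algebra_simps)
  note jordan = jordan_operator[of "?E 0 0 1" "?E 0 0 1" "?E 0 0 1"]
  have eigenvalue_c: "s * (2 * s - al) * (s - al) = 0"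
    using jordan[of "?E 0 1 0"]
    by (simp add: mulE comb_simps comb_eq_iff[OF B] algebra_simps)
  have eigenvalue_b: "i * (2 * i - al) * (i - al) = 0"
    using jordan[of "?E 1 0 0"]
    by (simp add: mulE comb_simps comb_eq_iff[OF B] algebra_simps)
  have compat: "al * s + 2 * i * i = al * i + 2 * i * s"
    using jordan_linearized[of "?E 0 0 1" "?E 0 0 1" "?E 1 0 0" "?E 1 0 0"]
    by (simp add: mulE comb_simps comb_eq_iff[OF B] algebra_simps)
  have "al = 2 * i \<or> al = i" using eigenvalue_b i0 by auto
  hence s: "s = 0 \<or> s = i \<or> s = 2 * i"
  proof
    assume "al = 2 * i"
    thus ?thesis using eigenvalue_c by auto
  next
    assume "al = i"
    hence "i * i = i * s" using compat by (simp add: algebra_simps)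
    thus ?thesis using i0 by simp
  qed
  \<comment> \<open>In the induced algebra \<open>y \<cdot> y = i b + t c\<close>; this vector multiplied by \<open>y\<close> gives \<open>i c\<close> from one side and
    \<open>(s / 2) c\<close> from the other, and the ratio determines the parameter.\<close>
  have chain: "ind_classified" if kap: "kap \<noteq> 0" and al: "al' \<in> {0, 1/3, 1}"
    and e1: "(1 + al') * kap = i" and e2: "(1 - al') * kap = s / 2" for kap al'
  proof -
    let ?v = "?E i t 0" and ?w = "?E 0 kap 0"
    have "basis3 (?E 0 0 1) ?v ?w" by (rule basis3_change[OF B]) (simp add: i0 kap)
    hence B': "basis3 (?E 0 0 1) ?v ?w" .
    have outer: "comb (?E 0 0 1) ?v ?w x1 x2 x3 = ?E (x2 * i) (x2 * t + x3 * kap) x1" for x1 x2 x3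
      unfolding comb_def[of "?E 0 0 1" ?v ?w] by (simp add: comb_simps)
    have "isomorphic_algebras smul (induced_mult mul R) (*s) (table_mult (A_4_1 al'))"
      by (rule ind.basis_table_isomorphic[OF B'])
        (simp_all add: A_4_1_def axis_def induced_mult_def outer RE mulE e1 e2 qi i0)
    thus ?thesis unfolding classified_def using al by blast
  qed
  from s show ?thesis
  proof (elim disjE)
    assume "s = 0"
    thus ?thesis using i0 by (intro chain[of "i / 2" 1]) simp_all
  next
    assume "s = i"
    thus ?thesis using i0 by (intro chain[of "3 * i / 4" "1/3"]) simp_all
  next
    assume "s = 2 * i"
    thus ?thesis using i0 by (intro chain[of i 0]) simp_all
  qed
qed

lemma range_subspace: "subspace (range R)"
proof (rule subspaceI)
  show "0 \<in> range R" using R_zero by (metis rangeI)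
  show "x + y \<in> range R" if "x \<in> range R" "y \<in> range R" for x y
    using that by (auto simp flip: R_add)
  show "smul c x \<in> range R" if "x \<in> range R" for c x
    using that by (auto simp flip: R_scale)
qed

lemma range_closed: "x \<in> range R \<Longrightarrow> y \<in> range R \<Longrightarrow> mul x y \<in> range R"
  by (auto simp: RB simp flip: R_add)

text \<open>The range acts on the kernel line by scalars. An element of square zero acts nilpotently, hence by 0; this
  applies to \<open>b \<circ> b\<close>, and then the operator identity for the vanishing cube of \<open>b\<close> says that the scalar by which
  \<open>b\<close> acts is nilpotent as well.\<close>

lemma annihilates_kernel_vector:
  assumes b: "b \<in> range R" and cube: "mul b (mul b b) = 0"
    and k: "R k = 0" and ker: "\<And>x. R x = 0 \<Longrightarrow> \<exists>c. x = smul c k"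
  shows "mul b k = 0"
proof -
  have eigen: "\<exists>t. mul (R x) k = smul t k" for x
    using ker[OF range_kernel[OF k]] by blast
  have sq: "mul b b \<in> range R"
    using b by (intro range_closed)
  obtain t where t: "mul b k = smul t k" using b eigen by (metis imageE)
  obtain s where s: "mul (mul b b) k = smul s k" using sq eigen by (metis imageE)
  have "mul (mul b b) (mul b b) = 0" using jordan_fourth_power[of b] cube by simp
  from square_zero_operator_cubed[OF this, of k]
  have "s = 0 \<or> k = 0" by (auto simp: s mult_scale_right)
  hence s0: "mul (mul b b) k = 0" using s by auto
  have "mul (mul (mul b b) b) k = 0" using cube by (simp add: commute[of "mul b b" b])
  hence "mul b (mul b (mul b k)) + mul b (mul b (mul b k)) = 0"
    using jordan_operator[of b b b k] s0
    by (simp add: t mult_scale_right) (metis add.right_inverse)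
  hence "smul (1 + 1) (mul b (mul b (mul b k))) = 0"
    by (simp only: scale_left_distrib scale_one)
  hence "t = 0 \<or> k = 0" by (auto simp: t mult_scale_right)
  thus ?thesis using t by auto
qed

text \<open>If \<open>R\<close> is not surjective, its range is the plane of \<open>b\<close> and \<open>c = b \<circ> b\<close>, and it annihilates the kernel
  line. A kernel vector outside the plane makes all induced products multiples of \<open>c\<close>. A kernel vector in the
  plane is annihilated by \<open>b\<close>, hence a multiple of \<open>c\<close>; replacing \<open>b\<close> by \<open>R y\<close> leads to
  \<open>classified_square_chain\<close>.\<close>

lemma classified_if_range_cubes_vanish:
  assumes cube: "\<And>x. mul (R x) (mul (R x) (R x)) = 0" and b: "b \<in> range R" and bb: "mul b b \<noteq> 0"
  shows ind_classified
proof (cases "surj R")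
  case True
  show ?thesis
    by (rule classified_if_cubes_vanish[OF _ bb]) (use cube True in \<open>metis surjD\<close>)
next
  case ns: False
  define c where "c = mul b b"
  have cubeb: "mul b (mul b b) = 0" using b cube by blast
  hence bc: "mul b c = 0" by (simp add: c_def)
  have cc: "mul c c = 0" using jordan_fourth_power[of b] cubeb by (simp add: c_def)
  have cb: "mul c b = 0" by (simp add: commute[of c b] bc)
  have c: "c \<in> range R"
    unfolding c_def using b by (intro range_closed)
  have b0: "b \<noteq> 0" using bb by auto
  have "c \<notin> span {b}"
  proof
    assume "c \<in> span {b}"
    then obtain k where k: "c = smul k b" by (auto simp: span_singleton)
    hence "smul k c = 0" using bc by (simp add: mult_scale_right c_def)
    thus False using k bb b0 by (auto simp: c_def)
  qed
  then obtain y where B: "basis3 b c y" using basis3_extend2[OF dim3 b0] by blast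
  obtain k where k0: "k \<noteq> 0" and Rk: "R k = 0" and ker: "\<And>x. R x = 0 \<Longrightarrow> \<exists>t. x = smul t k"
    and img: "\<And>x. \<exists>p q. R x = comb b c y p q 0"
    using kernel_of_rank_two[OF B b c ns] by blast
  obtain b1 b2 where Rb: "R b = comb b c y b1 b2 0" using img by blast
  obtain c1 c2 where Rc: "R c = comb b c y c1 c2 0" using img by blast
  have bk: "mul b k = 0" by (rule annihilates_kernel_vector[OF b cubeb Rk ker])
  have ck: "mul c k = 0"
    by (rule annihilates_kernel_vector[OF c _ Rk ker]) (simp add: cc)
  have "smul (c1 * c1) c = 0"
  proof -
    have "mul (R c) (R c) = smul (c1 * c1) c"
      by (simp add: Rc comb_def mult_add_left mult_add_right mult_scale_left mult_scale_right bc cb cc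
          flip: c_def)
    moreover have "mul c (R c) = 0"
      by (simp add: Rc comb_def mult_add_right mult_scale_right cb cc)
    ultimately show ?thesis using RB_square[of c] by simp
  qed
  hence c1: "c1 = 0" using bb by (simp add: c_def)
  obtain k1 k2 k3 where k: "k = comb b c y k1 k2 k3" using B by (rule basis3_coords)
  show ?thesis
  proof (cases "k3 = 0")
    case False
    have "basis3 (comb b c y 1 0 0) (comb b c y k1 k2 k3) (comb b c y 0 1 0)"
      by (rule basis3_change[OF B]) (simp add: False)
    hence B': "basis3 b k c" by (simp add: comb_unit k)
    have kb: "mul k b = 0" and kc: "mul k c = 0" using bk ck by (simp_all add: commute[of k])
    have ct: "mul c t = 0" for t
    proof -
      obtain x y' z where "t = comb b k c x y' z" using B' by (rule basis3_coords)
      thus ?thesis by (simp add: comb_def mult_add_right mult_scale_right cb ck cc)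
    qed
    show ?thesis
    proof (rule ind.classified_bilinear_form[OF B', of b1 0 0 0], unfold induced_mult_def)
      show "mul (R c) t = 0" for t by (simp add: Rc c1 comb_def mult_scale_left ct)
      show "mul (R t) c = 0" for t by (simp add: commute[of _ c] ct)
      show "mul (R b) b = smul b1 c"
        by (simp add: Rb comb_def mult_add_left mult_scale_left cb flip: c_def)
      show "mul (R b) k = smul 0 c"
        by (simp add: Rb comb_def mult_add_left mult_scale_left bk ck)
      show "mul (R k) b = smul 0 c" "mul (R k) k = smul 0 c" by (simp_all add: Rk)
    qed simp
  next
    case True
    have "smul k1 c = 0"
      using bk by (simp add: k True comb_def mult_add_right mult_scale_right bc flip: c_def)
    hence "k1 = 0" using bb by (simp add: c_def)
    hence "k = smul k2 c" using k True by (simp add: comb_def)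
    hence Rc0: "R c = 0" using Rk k0 by (auto simp: R_scale)
    have "smul (b1 * b1) c = 0"
    proof -
      have "mul (R b) (R b) = smul (b1 * b1) c"
        by (simp add: Rb comb_def mult_add_left mult_add_right mult_scale_left mult_scale_right bc cb cc
            flip: c_def)
      moreover have "mul b (R b) = smul b1 c"
        by (simp add: Rb comb_def mult_add_right mult_scale_right bc flip: c_def)
      ultimately show ?thesis using RB_square[of b] by (simp add: R_scale Rc0)
    qed
    hence "b1 = 0" using bb by (simp add: c_def)
    hence Rb: "R b = smul b2 c" using Rb by (simp add: comb_def)
    obtain y1 y2 where Ry: "R y = comb b c y y1 y2 0" using img by blast
    have RE: "R (comb b c y p q r) = comb b c y (r * y1) (p * b2 + r * y2) 0" for p q r
      by (simp add: R_comb Rb Rc0 Ry comb_scale) (simp add: comb_def scale_left_distrib)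
    obtain t where t: "b = R t" using b by blast
    obtain p q r where "t = comb b c y p q r" using B by (rule basis3_coords)
    note t[unfolded this]
    hence "comb b c y 1 0 0 = comb b c y (r * y1) (p * b2 + r * y2) 0" by (simp add: RE comb_unit)
    hence y1: "y1 \<noteq> 0" by (auto simp: comb_eq_iff[OF B])
    obtain t where t: "c = R t" using c by blast
    obtain p q r where "t = comb b c y p q r" using B by (rule basis3_coords)
    note t[unfolded this]
    hence "comb b c y 0 1 0 = comb b c y (r * y1) (p * b2 + r * y2) 0" by (simp add: RE comb_unit)
    hence b2: "b2 \<noteq> 0" using y1 by (auto simp: comb_eq_iff[OF B])
    let ?b = "comb b c y y1 y2 0" and ?c = "comb b c y 0 (y1 * y1) 0"
    have "basis3 ?b ?c (comb b c y 0 0 1)"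
      by (rule basis3_change[OF B]) (simp add: y1)
    hence B': "basis3 ?b ?c y" by (simp only: comb_unit)
    show ?thesis
    proof (rule classified_square_chain[OF B', of "b2 / y1"])
      show "mul ?b ?b = ?c" "mul ?b ?c = 0" "mul ?c ?c = 0"
        by (simp_all add: comb_def mult_add_left mult_add_right mult_scale_left mult_scale_right
            bc cb cc flip: c_def)
      show "R y = ?b" by (rule Ry)
      show "R ?b = smul (b2 / y1) ?c" "R ?c = 0"
        using y1 by (simp_all add: RE comb_scale comb_zero mult.commute)
      show "b2 / y1 \<noteq> 0" using b2 y1 by simp
    qed
  qed
qed

text \<open>The induced product is \<open>f(x) N y\<close>, where \<open>R x = f(x) v\<close> and \<open>N\<close> is multiplication by \<open>v\<close>. Here
  \<open>N\<^sup>3 = 0\<close>, and \<open>f\<close> vanishes on the image of \<open>N\<close>. If \<open>N\<^sup>2 a \<noteq> 0\<close>, the orbit of \<open>a\<close> is a basis with table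
  \<open>A_4_1 1\<close>. Otherwise \<open>N\<close> has rank at most one, and the product has values in its image.\<close>

lemma classified_rank_one_null:
  assumes a: "R a \<noteq> 0" and img: "\<And>x. \<exists>f. R x = smul f (R a)" and null: "mul (R a) (R a) = 0"
  shows ind_classified
proof -
  define v where "v = R a"
  let ?N = "mul v"
  have v0: "v \<noteq> 0" using a by (simp add: v_def)
  have cubed: "?N (?N (?N t)) = 0" for t
    using null by (intro square_zero_operator_cubed) (simp add: v_def)
  have "R (?N a) = 0" using RB_square[of a] null by (simp add: v_def commute[of a])
  moreover have RNk: "R (?N k) = 0" if "R k = 0" for k
    using range_kernel[OF that, of a] by (simp add: v_def)
  moreover have split: "\<exists>f k. x = smul f a + k \<and> R k = 0" for x
  proof -
    obtain f where "R x = smul f (R a)" using img by blast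
    hence "R (x - smul f a) = 0" by (simp add: R_diff R_scale)
    thus ?thesis by (metis add.commute diff_add_cancel)
  qed
  ultimately have RN: "R (?N t) = 0" for t
  proof -
    obtain f k where "t = smul f a + k" "R k = 0" using split by blast
    thus ?thesis using \<open>R (?N a) = 0\<close> RNk by (simp add: mult_add_right mult_scale_right R_add R_scale)
  qed
  have Ra: "R a = v" by (simp add: v_def)
  have a0: "a \<noteq> 0" using a by auto
  have adapted: "\<exists>k. R k = 0 \<and> basis3 a k w" if w: "w \<noteq> 0" "R w = 0" for w
  proof -
    have "w \<notin> span {a}"
    proof
      assume "w \<in> span {a}"
      then obtain t where "w = smul t a" by (auto simp: span_singleton)
      thus False using w v0 by (simp add: R_scale Ra)
    qed
    then obtain d where D: "basis3 a w d" using basis3_extend2[OF dim3 a0] by blast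
    obtain f k where d: "d = smul f a + k" "R k = 0" using split by blast
    have "basis3 (comb a w d 1 0 0) (comb a w d (- f) 0 1) (comb a w d 0 1 0)"
      by (rule basis3_change[OF D]) simp
    moreover have "comb a w d (- f) 0 1 = k" by (simp add: comb_def d(1))
    ultimately show ?thesis using d(2) by (auto simp: comb_unit)
  qed
  show ?thesis
  proof (cases "?N (?N a) = 0")
    case nn: False
    have B: "basis3 a (?N a) (?N (?N a))"
    proof (rule basis3_if_independent[OF dim3])
      fix x y z assume eq: "comb a (?N a) (?N (?N a)) x y z = 0"
      have N: "?N (comb a (?N a) (?N (?N a)) p q r) = comb a (?N a) (?N (?N a)) 0 p q" for p q r
        by (simp add: comb_def mult_add_right mult_scale_right cubed)
      have "?N (?N (comb a (?N a) (?N (?N a)) x y z)) = 0" using eq by simp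
      hence x: "x = 0" using nn unfolding N by (simp add: comb_def)
      have "?N (comb a (?N a) (?N (?N a)) x y z) = 0" using eq by simp
      hence y: "y = 0" using nn x unfolding N by (simp add: comb_def)
      show "x = 0 \<and> y = 0 \<and> z = 0" using eq nn x y by (simp add: comb_def)
    qed
    have "basis3 (comb a (?N a) (?N (?N a)) 1 0 0) (comb a (?N a) (?N (?N a)) 0 1 0)
        (comb a (?N a) (?N (?N a)) 0 0 (1/2))"
      by (rule basis3_change[OF B]) simp
    hence B': "basis3 a (?N a) (smul (1/2) (?N (?N a)))" by (simp add: comb_def)
    have "isomorphic_algebras smul (induced_mult mul R) (*s) (table_mult (A_4_1 1))"
      by (rule ind.basis_table_isomorphic[OF B'])
        (simp_all add: A_4_1_def axis_def induced_mult_def comb_def Ra RN R_scale cubed mult_scale_right)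
    thus ?thesis unfolding classified_def by blast
  next
    case nn: True
    show ?thesis
    proof (cases "\<exists>k. R k = 0 \<and> ?N k \<noteq> 0")
      case True
      then obtain k where k: "R k = 0" and Nk: "?N k \<noteq> 0" by blast
      have NNk: "?N (?N k) = 0"
      proof (rule ccontr)
        assume NN: "?N (?N k) \<noteq> 0"
        have B: "basis3 k (?N k) (?N (?N k))"
        proof (rule basis3_if_independent[OF dim3])
          fix x y z assume eq: "comb k (?N k) (?N (?N k)) x y z = 0"
          have N: "?N (comb k (?N k) (?N (?N k)) p q r) = comb k (?N k) (?N (?N k)) 0 p q" for p q r
            by (simp add: comb_def mult_add_right mult_scale_right cubed)
          have "?N (?N (comb k (?N k) (?N (?N k)) x y z)) = 0" using eq by simp
          hence x: "x = 0" using NN unfolding N by (simp add: comb_def)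
          have "?N (comb k (?N k) (?N (?N k)) x y z) = 0" using eq by simp
          hence y: "y = 0" using NN x unfolding N by (simp add: comb_def)
          show "x = 0 \<and> y = 0 \<and> z = 0" using eq NN x y by (simp add: comb_def)
        qed
        obtain x y z where "a = comb k (?N k) (?N (?N k)) x y z" using B by (rule basis3_coords)
        hence "R a = 0" by (simp add: R_comb k RN)
        thus False using a by simp
      qed
      have B: "basis3 a k (?N k)"
      proof (rule basis3_if_independent[OF dim3])
        fix x y z assume eq: "comb a k (?N k) x y z = 0"
        have "R (comb a k (?N k) x y z) = 0" using eq by simp
        hence x: "x = 0" using v0 by (simp add: R_comb Ra k RN)
        have "?N (comb a k (?N k) x y z) = 0" using eq by simp
        hence y: "y = 0" using Nk x by (simp add: comb_def mult_add_right mult_scale_right NNk)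
        show "x = 0 \<and> y = 0 \<and> z = 0" using eq Nk x y by (simp add: comb_def)
      qed
      obtain x y z where Na: "?N a = comb a k (?N k) x y z" using B by (rule basis3_coords)
      have "R (?N a) = 0" by (rule RN)
      hence x: "x = 0" using v0 by (simp add: Na R_comb Ra k RN)
      have "smul y (?N k) = ?N (?N a)"
        by (simp add: Na x comb_def mult_add_right mult_scale_right NNk)
      hence y: "y = 0" using nn Nk by simp
      have Na: "?N a = smul z (?N k)" using Na x y by (simp add: comb_def)
      show ?thesis
      proof (rule ind.classified_bilinear_form[OF B, of z 1 0 0], unfold induced_mult_def)
        show "mul (R (?N k)) t = 0" for t by (simp add: RN)
        show "mul (R t) (?N k) = 0" for t
          using img[of t] by (auto simp: Ra mult_scale_left NNk)
      qed (simp_all add: Ra k Na)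
    next
      case False
      hence Nker: "?N k = 0" if "R k = 0" for k using that by blast
      show ?thesis
      proof (cases "?N a = 0")
        case True
        have "?N t = 0" for t
          using split[of t] Nker True by (auto simp: mult_add_right mult_scale_right)
        hence "mul (R x) y = 0" for x y
          using img[of x] by (auto simp: Ra mult_scale_left)
        thus ?thesis by (rule classified_zero_product)
      next
        case Na: False
        obtain k where k: "R k = 0" and B: "basis3 a k (?N a)" using adapted[OF Na RN] by blast
        show ?thesis
        proof (rule ind.classified_bilinear_form[OF B, of 1 0 0 0], unfold induced_mult_def)
          show "mul (R (?N a)) t = 0" for t by (simp add: RN)
          show "mul (R t) (?N a) = 0" for t
            using img[of t] by (auto simp: Ra mult_scale_left nn)
        qed (simp_all add: Ra k Nker)
      qed
    qed
  qed
qed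

text \<open>In rank two, complete the range by \<open>y\<close>; since the range has zero product, \<open>R x \<circ> z\<close> is \<open>\<zeta>(z) (R x \<circ> y)\<close>
  for a functional \<open>\<zeta>\<close> that vanishes on the range. The Rota-Baxter identity puts \<open>R x \<circ> y\<close> into the kernel line of
  \<open>R\<close>, so the product is \<open>g(x) \<zeta>(z) k\<close>. If \<open>\<zeta>(k) \<noteq> 0\<close>, then \<open>R x\<close> has \<open>k\<close> as an
  eigenvector, and nilpotency of its multiplication operator makes the product zero.\<close>

lemma classified_if_range_null:
  assumes null: "\<And>x y. mul (R x) (R y) = 0"
  shows ind_classified
proof -
  consider "surj R" | "\<And>x. R x = 0" | a where "R a \<noteq> 0" "\<And>x. \<exists>f. R x = smul f (R a)"
    | a a' where "\<not> surj R" "R a \<noteq> 0" "R a' \<notin> span {R a}"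
  proof -
    assume 1: "surj R \<Longrightarrow> thesis" and 2: "(\<And>x. R x = 0) \<Longrightarrow> thesis"
      and 3: "\<And>a. R a \<noteq> 0 \<Longrightarrow> (\<And>x. \<exists>f. R x = smul f (R a)) \<Longrightarrow> thesis"
      and 4: "\<And>a a'. \<not> surj R \<Longrightarrow> R a \<noteq> 0 \<Longrightarrow> R a' \<notin> span {R a} \<Longrightarrow> thesis"
    show thesis
    proof (cases "\<exists>a. R a \<noteq> 0")
      case False
      thus thesis using 2 by blast
    next
      case True
      then obtain a where a: "R a \<noteq> 0" by blast
      show thesis
      proof (cases "\<exists>a'. R a' \<notin> span {R a}")
        case True
        thus thesis using 1 4 a by blast
      next
        case False
        hence "\<exists>f. R x = smul f (R a)" for x by (auto simp: span_singleton)
        thus thesis using 3 a by blast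
      qed
    qed
  qed
  thus ?thesis
  proof cases
    case 1
    hence "mul x y = 0" for x y using null by (metis surjD)
    thus ?thesis by (intro classified_zero_product) simp
  next
    case 2
    thus ?thesis by (intro classified_zero_product) simp
  next
    case (3 a)
    thus ?thesis using null by (intro classified_rank_one_null[of a])
  next
    case (4 a a')
    define v where "v = R a"
    define v' where "v' = R a'"
    obtain y where "basis3 (R a) (R a') y"
      using dim3 4(2,3) by (rule basis3_extend2)
    hence B: "basis3 v v' y" by (simp add: v_def v'_def)
    have vR: "v \<in> range R" "v' \<in> range R" by (simp_all add: v_def v'_def)
    obtain k where k0: "k \<noteq> 0" and Rk: "R k = 0" and ker: "\<And>x. R x = 0 \<Longrightarrow> \<exists>c. x = smul c k"
      using kernel_of_rank_two[OF B vR 4(1)] by metis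
    have last: "mul (R x) (comb v v' y p q r) = smul r (mul (R x) y)" for x p q r
      by (simp add: comb_def v_def v'_def mult_add_right mult_scale_right null)
    have "\<exists>z3. \<forall>x. mul (R x) z = smul z3 (mul (R x) y)" for z
    proof -
      obtain p q r where "z = comb v v' y p q r" using B by (rule basis3_coords)
      thus ?thesis using last by blast
    qed
    then obtain zeta where zeta: "\<And>x z. mul (R x) z = smul (zeta z) (mul (R x) y)" by metis
    have Ryy: "R (mul (R y) y) = 0"
      using RB_square[of y] null by (simp add: commute[of y "R y"])
    have "R (mul (R x) y) = 0" for x
    proof -
      have "mul x (R y) = smul (zeta x) (mul (R y) y)"
        using zeta[of y x] by (simp add: commute[of x])
      hence "R (mul x (R y)) = 0" by (simp add: R_scale Ryy)
      thus ?thesis using RB[of x y] null by simp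
    qed
    hence "\<exists>g. mul (R x) y = smul g k" for x using ker by blast
    then obtain g where g: "\<And>x. mul (R x) y = smul (g x) k" by metis
    have prod: "mul (R x) z = smul (g x * zeta z) k" for x z
      using zeta[of x z] by (simp add: g mult.commute)
    show ?thesis
    proof (cases "zeta k = 0")
      case True
      obtain d1 d2 where D: "basis3 k d1 d2" using basis3_extend1[OF dim3 k0] by blast
      have "basis3 (comb k d1 d2 0 1 0) (comb k d1 d2 0 0 1) (comb k d1 d2 1 0 0)"
        by (rule basis3_change[OF D]) simp
      hence D': "basis3 d1 d2 k" by (simp only: comb_unit)
      show ?thesis
        by (rule ind.classified_rank_one[OF D', of g zeta])
          (simp_all add: induced_mult_def Rk prod True)
    next
      case False
      have "g x = 0" for x
        using square_zero_operator_cubed[OF null[of x x], of k] k0 False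
        by (simp add: prod mult_scale_right)
      thus ?thesis by (intro classified_zero_product) (simp add: prod)
    qed
  qed
qed

section \<open>The classification\<close>

text \<open>Polarising squares turns the last case into the vanishing of the whole product on the range.\<close>

theorem induced_classified: ind_classified
proof (cases "\<exists>e y. e \<noteq> 0 \<and> mul e e = e \<and> R y = e")
  case True
  thus ?thesis using classified_if_idempotent_in_range by blast
next
  case no_idem: False
  have nil: "jpow (R x) 3 = 0" for x
  proof (rule nilpotent_if_no_idempotent[OF dim3 range_subspace])
    show "R x \<in> range R" by simp
    show "mul y z \<in> range R" if "y \<in> range R" "z \<in> range R" for y z
      using that by (rule range_closed)
    show "e = 0" if "e \<in> range R" "mul e e = e" for e
      using no_idem that by (metis imageE)
  qed
  have jp: "jpow b (Suc 0) = mul b b" "jpow b 2 = mul b (mul b b)" "jpow b 3 = mul b (jpow b 2)" for b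
    by (simp_all add: jpow_def numeral_2_eq_2 numeral_3_eq_3)
  consider x where "mul (R x) (mul (R x) (R x)) \<noteq> 0"
    | x where "\<And>x. mul (R x) (mul (R x) (R x)) = 0" "mul (R x) (R x) \<noteq> 0"
    | "\<And>x. mul (R x) (R x) = 0"
    by blast
  thus ?thesis
  proof cases
    case (1 x)
    define b where "b = R x"
    let ?b2 = "mul b b" let ?b3 = "mul b (mul b b)"
    have b3: "?b3 \<noteq> 0" using 1 by (simp add: b_def)
    have b4: "jpow b n = 0" if "n \<ge> 3" for n
      using that nil[of x] by (induction rule: dec_induct) (simp_all add: b_def jpow_Suc)
    have p: "mul b ?b3 = 0" "mul ?b2 ?b2 = 0" "mul ?b2 ?b3 = 0" "mul ?b3 ?b3 = 0"
      using jpow_mul[of b 0 2] jpow_mul[of b 1 1] jpow_mul[of b 1 2] jpow_mul[of b 2 2]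
      by (simp_all add: b4 jp)
    have B: "basis3 b ?b2 ?b3"
    proof (rule basis3_if_independent[OF dim3])
      fix x y z assume eq: "comb b ?b2 ?b3 x y z = 0"
      have N: "mul b (comb b ?b2 ?b3 p q r) = comb b ?b2 ?b3 0 p q" for p q r
        by (simp add: comb_def mult_add_right mult_scale_right p)
      have "mul b (mul b (comb b ?b2 ?b3 x y z)) = 0" using eq by simp
      hence x: "x = 0" using b3 unfolding N by (simp add: comb_def)
      have "mul b (comb b ?b2 ?b3 x y z) = 0" using eq by simp
      hence y: "y = 0" using b3 x unfolding N by (simp add: comb_def)
      show "x = 0 \<and> y = 0 \<and> z = 0" using eq b3 x y by (simp add: comb_def)
    qed
    show ?thesis by (rule classified_power_basis[OF B]) (simp_all add: p)
  next
    case (2 x)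
    thus ?thesis by (intro classified_if_range_cubes_vanish[of "R x"]) auto
  next
    case 3
    have "mul (R x) (R y) = 0" for x y
    proof -
      have "mul (R (x + y)) (R (x + y)) = 0" by (rule 3)
      hence "smul (1 + 1) (mul (R x) (R y)) = 0"
        by (simp only: R_add mult_add_left mult_add_right 3 commute[of "R y" "R x"]
            scale_left_distrib scale_one add_0_left add_0_right)
      thus ?thesis by simp
    qed
    thus ?thesis by (rule classified_if_range_null)
  qed
qed

end

theorem theorem5p32:
  fixes smul :: "complex \<Rightarrow> 'a::ab_group_add \<Rightarrow> 'a"
    and mul :: "'a \<Rightarrow> 'a \<Rightarrow> 'a"
    and R :: "'a \<Rightarrow> 'a"
  assumes "jordan_algebra smul mul"
    and "vector_space.dim smul (UNIV :: 'a set) = 3"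
    and "rota_baxter_operator smul mul R"
  shows "\<exists>M \<in> {J_4_8, A_1_3_2, A_1_4_3, A_2_2} \<union> A_4_1 ` {0, 1/3, 1} \<union> range A_6_1 \<union> {A_7_2, A_8_1}.
           isomorphic_algebras smul (induced_mult mul R) (*s) (table_mult M)"
proof -
  have "rota_baxter_jordan3 smul mul R"
    using assms by (intro rota_baxter_jordan3.intro rota_baxter_jordan3_axioms.intro)
  hence "classified smul (induced_mult mul R)"
    by (rule rota_baxter_jordan3.induced_classified)
  thus ?thesis unfolding classified_def .
qed

end
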